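(* Let $r\ge 2$ and $k\ge 3$ be given and let $\widehat{F}_k$ be an $r$-coloring of $K_k$ which is not monochromatic and whose pattern is different from the pattern $T_0$. Assume also that if $r=2$ then the pattern of $\widehat{F}_k$ is different from the pattern $P_2$. Then every $(r,\widehat{F}_k)$-extremal graph is a complete multipartite graph.
   Context: All graphs are finite and simple. An $r$-coloring of a graph is an arbitrary (not necessarily proper) assignment of colors from $\{1,\dots,r\}$ to its edges. The pattern of a colored graph is the partition of its edge set into color classes (color names are ignored). Given an $r$-coloring of a graph $G$, a copy of $\widehat{F}_k$ is a set of $k$ pairwise adjacent vertices of $G$ admitting a bijection to $V(K_k)$ under which two edges have the same color in $G$ iff their images have the same color in $\widehat{F}_k$. A coloring is $\widehat{F}_k$-free if it has no copy of $\widehat{F}_k$. $c_{r,\widehat{F}_k}(G)$ is the number of $\widehat{F}_k$-free $r$-colorings of $E(G)$, $c_{r,\widehat{F}_k}(n)$ its maximum over $n$-vertex graphs, and an $n$-vertex $G$ is $(r,\widehat{F}_k)$-extremal if $c_{r,\widehat{F}_k}(G)=c_{r,\widehat{F}_k}(n)$. The pattern $T_0$ is the coloring of the triangle $K_3$ in which two edges have one color and the third edge a different color. The pattern $P_2$ is the coloring of $K_4$ on vertices $a,b,c,d$ in which the edges $ac,bc,bd,cd$ have one color and the edges $ab,ad$ have a second color. *)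

theory Defs
  imports Main "HOL-Library.FuncSet" "HOL-Library.Disjoint_Sets"
begin

definition graph :: "'a set \<Rightarrow> 'a set set \<Rightarrow> bool" where
  "graph V E \<longleftrightarrow> finite V \<and> E \<subseteq> {{u, v} | u v. u \<in> V \<and> v \<in> V \<and> u \<noteq> v}"

definition Kedges :: "nat \<Rightarrow> nat set set" where
  "Kedges k = {{i, j} | i j. i < k \<and> j < k \<and> i \<noteq> j}"

definition coloring_K :: "nat \<Rightarrow> nat \<Rightarrow> (nat set \<Rightarrow> nat) \<Rightarrow> bool" where
  "coloring_K r k F \<longleftrightarrow> F \<in> Kedges k \<rightarrow>\<^sub>E {1..r}"

definition monochromatic :: "nat \<Rightarrow> (nat set \<Rightarrow> nat) \<Rightarrow> bool" where
  "monochromatic k F \<longleftrightarrow> (\<exists>c. \<forall>e\<in>Kedges k. F e = c)"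

text \<open>Two coloured complete graphs have the same pattern if some vertex bijection maps
  the partition into colour classes of one onto that of the other.\<close>
definition same_pattern :: "nat \<Rightarrow> (nat set \<Rightarrow> nat) \<Rightarrow> nat \<Rightarrow> (nat set \<Rightarrow> nat) \<Rightarrow> bool" where
  "same_pattern k F k' F' \<longleftrightarrow>
     (\<exists>\<phi>. bij_betw \<phi> {0..<k} {0..<k'} \<and>
        (\<forall>e\<in>Kedges k. \<forall>e'\<in>Kedges k. F e = F e' \<longleftrightarrow> F' (\<phi> ` e) = F' (\<phi> ` e')))"

text \<open>Pattern T_0 on K_3: edges {0,1},{1,2} one colour, {0,2} another.\<close>
definition T0 :: "nat set \<Rightarrow> nat" where
  "T0 e = (if e = {0, 2} then 2 else 1)"

text \<open>Pattern P_2 on K_4 with a=0,b=1,c=2,d=3: ac,bc,bd,cd one colour; ab,ad a second.\<close>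
definition P2 :: "nat set \<Rightarrow> nat" where
  "P2 e = (if e = {0, 1} \<or> e = {0, 3} then 2 else 1)"

definition is_copy :: "'a set \<Rightarrow> 'a set set \<Rightarrow> ('a set \<Rightarrow> nat) \<Rightarrow> nat \<Rightarrow> (nat set \<Rightarrow> nat) \<Rightarrow> 'a set \<Rightarrow> bool" where
  "is_copy V E c k F S \<longleftrightarrow> S \<subseteq> V \<and> card S = k \<and>
     (\<forall>u\<in>S. \<forall>v\<in>S. u \<noteq> v \<longrightarrow> {u, v} \<in> E) \<and>
     (\<exists>\<phi>. bij_betw \<phi> S {0..<k} \<and>
        (\<forall>u1\<in>S. \<forall>v1\<in>S. \<forall>u2\<in>S. \<forall>v2\<in>S. u1 \<noteq> v1 \<longrightarrow> u2 \<noteq> v2 \<longrightarrow>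
           (c {u1, v1} = c {u2, v2} \<longleftrightarrow> F {\<phi> u1, \<phi> v1} = F {\<phi> u2, \<phi> v2})))"

definition F_free :: "'a set \<Rightarrow> 'a set set \<Rightarrow> ('a set \<Rightarrow> nat) \<Rightarrow> nat \<Rightarrow> (nat set \<Rightarrow> nat) \<Rightarrow> bool" where
  "F_free V E c k F \<longleftrightarrow> \<not> (\<exists>S. is_copy V E c k F S)"

definition count_free :: "nat \<Rightarrow> nat \<Rightarrow> (nat set \<Rightarrow> nat) \<Rightarrow> 'a set \<Rightarrow> 'a set set \<Rightarrow> nat" where
  "count_free r k F V E = card {c \<in> E \<rightarrow>\<^sub>E {1..r}. F_free V E c k F}"

definition count_free_n :: "nat \<Rightarrow> nat \<Rightarrow> (nat set \<Rightarrow> nat) \<Rightarrow> nat \<Rightarrow> nat" where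
  "count_free_n r k F n = Max {count_free r k F {0..<n} E | E. graph {0..<n} E}"

definition extremal :: "nat \<Rightarrow> nat \<Rightarrow> (nat set \<Rightarrow> nat) \<Rightarrow> 'a set \<Rightarrow> 'a set set \<Rightarrow> bool" where
  "extremal r k F V E \<longleftrightarrow> graph V E \<and> count_free r k F V E = count_free_n r k F (card V)"

definition complete_multipartite :: "'a set \<Rightarrow> 'a set set \<Rightarrow> bool" where
  "complete_multipartite V E \<longleftrightarrow>
     (\<exists>P. partition_on V P \<and>
        (\<forall>u\<in>V. \<forall>v\<in>V. u \<noteq> v \<longrightarrow> ({u, v} \<in> E \<longleftrightarrow> \<not> (\<exists>A\<in>P. u \<in> A \<and> v \<in> A))))"

end

theory Submission
  imports Defs "HOL-Combinatorics.Transposition"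
begin

text \<open>Let \<open>u\<close> and \<open>v\<close> be nonadjacent in an extremal graph. Replacing one of them by a twin of the
  other cannot increase the number of free colourings, and the equality case of Cauchy--Schwarz shows
  that every free colouring of the graph without \<open>u\<close> and \<open>v\<close> extends to \<open>u\<close> in as many ways as to \<open>v\<close>;
  moreover the graph with the twin is again extremal. Suppose now that \<open>v\<close> is nonadjacent to \<open>u\<close> and \<open>w\<close>
  but \<open>uw\<close> is an edge. Then a colouring \<open>\<tau>\<close> of the graph without \<open>u\<close> and \<open>v\<close> extends to \<open>u\<close> in exactly as
  many ways as its restriction to the graph without \<open>u\<close>, \<open>v\<close> and \<open>w\<close> does. This fails if \<open>\<tau>\<close> is constant
  1, or constant 1 except that the edges at \<open>w\<close> get colour 2: every extension of the restriction
  can be completed by some colour of \<open>uw\<close>, and one of them by two colours. Constant 1 works unless \<open>F\<close>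
  has a vertex \<open>x\<close> with \<open>F - x\<close> monochromatic in a colour that also occurs at \<open>x\<close>.\<close>

section \<open>Deleting a vertex and replacing a vertex by a twin\<close>

definition del :: "'a \<Rightarrow> 'a set set \<Rightarrow> 'a set set" where
  "del x E = {e \<in> E. x \<notin> e}"

lemma del_commute: "del x (del y E) = del y (del x E)"
  by (auto simp: del_def)

lemma not_in_del: "e \<notin> E \<Longrightarrow> e \<notin> del x E"
  by (simp add: del_def)

lemma del_subset: "del x E \<subseteq> E"
  by (auto simp: del_def)

definition simple :: "'a set set \<Rightarrow> bool" where
  "simple E \<longleftrightarrow> finite E \<and> (\<forall>e\<in>E. card e = 2)"

lemma simple_subset: "simple E \<Longrightarrow> E' \<subseteq> E \<Longrightarrow> simple E'"
  by (auto simp: simple_def finite_subset)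

lemma simple_del: "simple E \<Longrightarrow> simple (del x E)"
  by (rule simple_subset[OF _ del_subset])

lemma graph_simple:
  assumes "graph V E"
  shows "simple E"
proof -
  have "E \<subseteq> Pow V" "finite V"
    using assms by (auto simp: graph_def)
  then have "finite E"
    by (meson finite_Pow_iff finite_subset)
  then show ?thesis
    using assms by (fastforce simp: simple_def graph_def)
qed

lemma simple_both:
  assumes "simple E" "e \<in> E" "x \<in> e" "y \<in> e" "x \<noteq> y"
  shows "e = {x, y}"
  using assms by (auto simp: simple_def card_2_iff)

text \<open>Replaces \<open>v\<close> by a nonadjacent twin of \<open>u\<close>: the transposition
  fixes the edges of \<open>del v E\<close> that miss \<open>u\<close> and carries those at
  \<open>u\<close> to \<open>v\<close>.\<close>

definition clone :: "'a \<Rightarrow> 'a \<Rightarrow> 'a set set \<Rightarrow> 'a set set" where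
  "clone u v E = del v E \<union> (`) (transpose u v) ` del v E"

lemma transpose_image_id: "u \<notin> e \<Longrightarrow> v \<notin> e \<Longrightarrow> transpose u v ` e = e"
  by (force simp: transpose_def)

lemma transpose_image_image: "transpose u v ` transpose u v ` e = e"
  by (simp add: image_image)

lemma transpose_mem_left: "u \<in> transpose u v ` e \<longleftrightarrow> v \<in> e"
  by (force simp: transpose_def)

lemma transpose_mem_right: "v \<in> transpose u v ` e \<longleftrightarrow> u \<in> e"
  by (force simp: transpose_def)

lemma del_clone_right: "del v (clone u v E) = del v E"
  by (auto simp: clone_def del_def transpose_mem_right transpose_image_id)

text \<open>Dropping the original and keeping the twin gives a graph isomorphic to
  \<open>del v E\<close> under the transposition; \<open>card_exts_clone\<close> counts through this
  isomorphism.\<close>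

lemma del_clone_left: "del u (clone u v E) = (`) (transpose u v) ` del v E"
proof -
  have "e \<in> (`) (transpose u v) ` del v E" if "e \<in> del v E" "u \<notin> e" for e
    using that by (intro image_eqI[of _ _ e]) (simp_all add: del_def transpose_image_id)
  moreover have "u \<notin> transpose u v ` e" if "e \<in> del v E" for e
    using that unfolding transpose_mem_left by (simp add: del_def)
  ultimately show ?thesis
    unfolding clone_def by (auto simp only: del_def[of u])
qed

lemma graph_clone:
  assumes "graph V E" "u \<in> V" "v \<in> V"
  shows "graph V (clone u v E)"
proof -
  have "transpose u v ` e \<in> {{x, y} | x y. x \<in> V \<and> y \<in> V \<and> x \<noteq> y}" if "e \<in> E" for e
  proof -
    obtain x y where "e = {x, y}" "x \<in> V" "y \<in> V" "x \<noteq> y"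
      using \<open>e \<in> E\<close> assms(1) by (auto simp: graph_def)
    then have "transpose u v ` e = {transpose u v x, transpose u v y}"
      "transpose u v x \<in> V" "transpose u v y \<in> V" "transpose u v x \<noteq> transpose u v y"
      using assms(2,3) by (auto simp: transpose_def)
    then show ?thesis
      by blast
  qed
  then show ?thesis
    using assms(1) by (auto simp: graph_def clone_def del_def)
qed

lemma clone_nonadjacent:
  assumes "u \<noteq> v"
  shows "{u, v} \<notin> clone u v E"
  using assms transpose_mem_left[of u v] by (auto simp: clone_def del_def)

section \<open>Labelled copies of the pattern and free colourings\<close>

context
  fixes r k :: nat and F :: "nat set \<Rightarrow> nat"
begin

text \<open>Labelled counterpart of \<open>is_copy\<close>: the map runs from the indices of the
  pattern into the graph, and the vertex set enters only through the edges, which makes copies easy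
  to move between graphs.\<close>

definition emb :: "'a set set \<Rightarrow> ('a set \<Rightarrow> nat) \<Rightarrow> (nat \<Rightarrow> 'a) \<Rightarrow> bool" where
  "emb E c \<psi> \<longleftrightarrow> inj_on \<psi> {..<k} \<and>
     (\<forall>i<k. \<forall>j<k. i \<noteq> j \<longrightarrow> {\<psi> i, \<psi> j} \<in> E) \<and>
     (\<forall>i<k. \<forall>j<k. \<forall>i'<k. \<forall>j'<k. i \<noteq> j \<longrightarrow> i' \<noteq> j' \<longrightarrow>
        (c {\<psi> i, \<psi> j} = c {\<psi> i', \<psi> j'} \<longleftrightarrow> F {i, j} = F {i', j'}))"

lemma emb_inj: "emb E c \<psi> \<Longrightarrow> i < k \<Longrightarrow> j < k \<Longrightarrow> \<psi> i = \<psi> j \<longleftrightarrow> i = j"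
  by (auto simp: emb_def inj_on_def)

lemma emb_edge: "emb E c \<psi> \<Longrightarrow> i < k \<Longrightarrow> j < k \<Longrightarrow> i \<noteq> j \<Longrightarrow> {\<psi> i, \<psi> j} \<in> E"
  by (simp add: emb_def)

lemma emb_color:
  "emb E c \<psi> \<Longrightarrow> i < k \<Longrightarrow> j < k \<Longrightarrow> i' < k \<Longrightarrow> j' < k \<Longrightarrow> i \<noteq> j \<Longrightarrow> i' \<noteq> j' \<Longrightarrow>
    c {\<psi> i, \<psi> j} = c {\<psi> i', \<psi> j'} \<longleftrightarrow> F {i, j} = F {i', j'}"
  by (simp add: emb_def)

lemma emb_transfer:
  assumes "emb E c \<psi>" "\<And>i j. i < k \<Longrightarrow> j < k \<Longrightarrow> i \<noteq> j \<Longrightarrow> {\<psi> i, \<psi> j} \<in> E'"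
    "\<And>e. e \<in> E \<Longrightarrow> e \<in> E' \<Longrightarrow> c' e = c e"
  shows "emb E' c' \<psi>"
proof -
  have "c' {\<psi> i, \<psi> j} = c {\<psi> i, \<psi> j}" if "i < k" "j < k" "i \<noteq> j" for i j
    using assms(3)[OF emb_edge[OF assms(1) that] assms(2)[OF that]] .
  then show ?thesis
    using assms(1,2) by (simp add: emb_def)
qed

definition free :: "'a set set \<Rightarrow> ('a set \<Rightarrow> nat) \<Rightarrow> bool" where
  "free E c \<longleftrightarrow> (\<nexists>\<psi>. emb E c \<psi>)"

lemma free_subset:
  assumes "free E c" "E' \<subseteq> E" "\<And>e. e \<in> E' \<Longrightarrow> c' e = c e"
  shows "free E' c'"
  unfolding free_def
proof
  assume "\<exists>\<psi>. emb E' c' \<psi>"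
  then obtain \<psi> where "emb E' c' \<psi>" ..
  then have "emb E c \<psi>"
    by (rule emb_transfer) (use assms(2) emb_edge[OF \<open>emb E' c' \<psi>\<close>] in blast, use assms(3) in simp)
  then show False
    using assms(1) by (auto simp: free_def)
qed

text \<open>A copy that misses \<open>x\<close> uses only edges of \<open>del x E\<close>.\<close>

lemma emb_avoid:
  assumes "emb E c \<psi>" "free (del x E) c"
  obtains i where "i < k" "\<psi> i = x"
proof -
  have "\<exists>i<k. \<psi> i = x"
  proof (rule ccontr)
    assume "\<not> (\<exists>i<k. \<psi> i = x)"
    then have "emb (del x E) c \<psi>"
      using emb_edge[OF assms(1)] by (intro emb_transfer[OF assms(1)]) (auto simp: del_def)
    then show False
      using assms(2) by (auto simp: free_def)
  qed
  then show ?thesis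
    using that by blast
qed

text \<open>A copy would have to use both \<open>a\<close> and \<open>b\<close> by
  \<open>emb_avoid\<close>, yet the vertices of a copy are pairwise adjacent. This independence of
  nonadjacent vertices is the source of the product formula below.\<close>

lemma free_glue:
  assumes "a \<noteq> b" "{a, b} \<notin> E" "free (del a E) c" "free (del b E) c"
  shows "free E c"
  unfolding free_def
proof
  assume "\<exists>\<psi>. emb E c \<psi>"
  then obtain \<psi> where \<psi>: "emb E c \<psi>" ..
  obtain i j where "i < k" "\<psi> i = a" "j < k" "\<psi> j = b"
    using emb_avoid[OF \<psi>] assms(3,4) by metis
  then show False
    using emb_edge[OF \<psi>, of i j] assms(1,2) by auto
qed

section \<open>Counting the extensions of a colouring to a deleted vertex\<close>

definition cols :: "'a set set \<Rightarrow> ('a set \<Rightarrow> nat) set" where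
  "cols E = {c \<in> E \<rightarrow>\<^sub>E {1..r}. free E c}"

lemma finite_cols: "finite E \<Longrightarrow> finite (cols E)"
  by (simp add: cols_def finite_PiE)

lemma restrict_cols:
  assumes "c \<in> cols E" "E' \<subseteq> E"
  shows "restrict c E' \<in> cols E'"
proof -
  have "free E' (restrict c E')"
    using assms by (intro free_subset[of E c E']) (auto simp: cols_def)
  moreover have "restrict c E' \<in> E' \<rightarrow>\<^sub>E {1..r}"
    using assms by (auto simp: cols_def)
  ultimately show ?thesis
    by (simp add: cols_def)
qed

definition exts :: "'a \<Rightarrow> 'a set set \<Rightarrow> ('a set \<Rightarrow> nat) \<Rightarrow> ('a set \<Rightarrow> nat) set" where
  "exts x E \<tau> = {c \<in> cols E. restrict c (del x E) = \<tau>}"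

lemma finite_exts: "simple E \<Longrightarrow> finite (exts x E \<tau>)"
  by (simp add: exts_def finite_cols simple_def)

text \<open>Groups the colourings by their restriction to \<open>del x E\<close>. The weight
  \<open>g\<close> lets the formula be applied twice in a row, first with weight 1 and then with an
  extension count as weight.\<close>

lemma sum_exts:
  fixes g :: "('a set \<Rightarrow> nat) \<Rightarrow> nat"
  assumes "simple E"
  shows "(\<Sum>c\<in>cols E. g (restrict c (del x E))) = (\<Sum>\<tau>\<in>cols (del x E). card (exts x E \<tau>) * g \<tau>)"
proof -
  have fin: "finite (cols E)" "finite (cols (del x E))"
    using assms simple_del[OF assms, of x] by (simp_all add: simple_def finite_cols)
  have "(\<Sum>c\<in>cols E. g (restrict c (del x E))) =
      (\<Sum>\<tau>\<in>cols (del x E). \<Sum>c | c \<in> cols E \<and> restrict c (del x E) = \<tau>. g (restrict c (del x E)))"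
    using fin restrict_cols[OF _ del_subset] by (intro sum.group[symmetric]) auto
  also have "\<dots> = (\<Sum>\<tau>\<in>cols (del x E). card (exts x E \<tau>) * g \<tau>)"
    by (intro sum.cong) (simp_all add: exts_def)
  finally show ?thesis .
qed

text \<open>No edge contains both \<open>a\<close> and \<open>b\<close>, and by
  \<open>free_glue\<close> no copy does, so the colours at \<open>b\<close> do not influence the
  extensions to \<open>a\<close>. The bijection forgets the edges at \<open>b\<close>; its inverse
  takes them back from \<open>\<tau>\<close>.\<close>

lemma card_exts_del:
  assumes "simple E" "a \<noteq> b" "{a, b} \<notin> E" "\<tau> \<in> cols (del a E)"
  shows "card (exts a E \<tau>) = card (exts a (del b E) (restrict \<tau> (del a (del b E))))"
proof -
  let ?E0 = "del a (del b E)"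
  let ?f = "\<lambda>c. restrict c (del b E)"
  let ?g = "\<lambda>c. \<lambda>e\<in>E. if b \<in> e then \<tau> e else c e"
  have "?f c \<in> exts a (del b E) (restrict \<tau> ?E0)" if "c \<in> exts a E \<tau>" for c
  proof -
    have "restrict c (del b E) \<in> cols (del b E)" "restrict c (del a E) = \<tau>"
      using that restrict_cols[OF _ del_subset] by (auto simp: exts_def)
    moreover have "?E0 \<inter> del b E = ?E0" "?E0 \<inter> del a E = ?E0"
      by (auto simp: del_def)
    ultimately show ?thesis
      by (auto simp: exts_def Int_commute)
  qed
  moreover have "?g c \<in> exts a E \<tau>" if c: "c \<in> exts a (del b E) (restrict \<tau> ?E0)" for c
  proof -
    have eq: "c e = \<tau> e" if "e \<in> ?E0" for e
    proof -
      have "restrict c ?E0 = restrict \<tau> ?E0"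
        using c by (simp add: exts_def)
      then show ?thesis
        using that by (metis restrict_apply')
    qed
    have no: "a \<notin> e" if "e \<in> E" "b \<in> e" for e
      using simple_both[OF assms(1) that(1), of a b] that assms(2,3) by auto
    have on_a: "?g c e = \<tau> e" if "e \<in> del a E" for e
      using eq[of e] that by (auto simp: del_def)
    have "free E (?g c)"
    \<comment> \<open>Away from \<open>a\<close> the glued colouring is \<open>\<tau>\<close>, away
      from \<open>b\<close> it is \<open>c\<close>, and both are free.\<close>
    proof (rule free_glue[OF assms(2,3)])
      show "free (del a E) (?g c)"
      proof (rule free_subset[of "del a E" \<tau>])
        show "free (del a E) \<tau>"
          using assms(4) by (simp add: cols_def)
      qed (simp_all only: on_a subset_refl)
      show "free (del b E) (?g c)"
      proof (rule free_subset[of "del b E" c])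
        show "free (del b E) c"
          using c by (simp add: exts_def cols_def)
      qed (simp_all add: del_def)
    qed
    moreover have "?g c \<in> E \<rightarrow>\<^sub>E {1..r}"
    proof (rule PiE_I)
      fix e assume "e \<in> E"
      then have "e \<in> del a E \<or> e \<in> del b E" "b \<in> e \<Longrightarrow> e \<in> del a E" "b \<notin> e \<Longrightarrow> e \<in> del b E"
        using no by (auto simp: del_def)
      then show "?g c e \<in> {1..r}"
        using \<open>e \<in> E\<close> c assms(4) by (auto simp: exts_def cols_def PiE_iff)
    qed auto
    moreover have "restrict (?g c) (del a E) = \<tau>"
    proof
      fix e
      show "restrict (?g c) (del a E) e = \<tau> e"
        using on_a[of e] assms(4) by (cases "e \<in> del a E") (auto simp: cols_def PiE_iff extensional_def)
    qed
    ultimately show ?thesis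
      by (simp add: exts_def cols_def)
  qed
  moreover have "?g (?f c) = c" if c: "c \<in> exts a E \<tau>" for c
  proof
    fix e
    \<comment> \<open>Edges at \<open>b\<close> miss \<open>a\<close>, where \<open>c\<close> agrees
      with \<open>\<tau>\<close>, so the forgotten colours are recovered.\<close>
    have "b \<in> e \<Longrightarrow> e \<in> E \<Longrightarrow> e \<in> del a E"
      using simple_both[OF assms(1), of e a b] assms(2,3) by (auto simp: del_def)
    then show "?g (?f c) e = c e"
      using c by (auto simp: exts_def cols_def PiE_iff extensional_def del_def)
  qed
  moreover have "?f (?g c) = c" if "c \<in> exts a (del b E) (restrict \<tau> ?E0)" for c
    using that by (auto simp: exts_def cols_def PiE_iff extensional_def del_def fun_eq_iff)
  ultimately have "bij_betw ?f (exts a E \<tau>) (exts a (del b E) (restrict \<tau> ?E0))"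
    by (intro bij_betwI[where g = ?g]) auto
  then show ?thesis
    by (rule bij_betw_same_card)
qed

text \<open>Fibre first over the colourings of \<open>del a E\<close>, then over those of
  \<open>del a (del b E)\<close>; in between, \<open>card_exts_del\<close> makes the first count
  depend only on the smaller restriction.\<close>

lemma card_cols_split:
  assumes "simple E" "a \<noteq> b" "{a, b} \<notin> E"
  shows "card (cols E) = (\<Sum>\<tau>\<in>cols (del a (del b E)).
    card (exts a (del b E) \<tau>) * card (exts b (del a E) \<tau>))"
proof -
  let ?h = "\<lambda>\<tau>. card (exts a (del b E) \<tau>)"
  have "card (cols E) = (\<Sum>\<tau>\<in>cols (del a E). card (exts a E \<tau>))"
    using sum_exts[OF assms(1), of "\<lambda>_. 1" a] by simp
  also have "\<dots> = (\<Sum>\<tau>\<in>cols (del a E). ?h (restrict \<tau> (del b (del a E))))"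
    using card_exts_del[OF assms] by (simp add: del_commute)
  also have "\<dots> = (\<Sum>\<tau>\<in>cols (del b (del a E)). card (exts b (del a E) \<tau>) * ?h \<tau>)"
    using sum_exts[OF simple_del[OF assms(1)], of ?h b a] by simp
  finally show ?thesis
    by (simp add: del_commute mult.commute)
qed

section \<open>Transport of colourings along vertex maps\<close>

lemma pullback_cols:
  assumes "inj_on f (\<Union>E1)" "E2 = (`) f ` E1" "c \<in> cols E2"
  shows "(\<lambda>e\<in>E1. c (f ` e)) \<in> cols E1"
proof -
  have "\<not> emb E1 (\<lambda>e\<in>E1. c (f ` e)) \<psi>" for \<psi>
  proof
    assume emb: "emb E1 (\<lambda>e\<in>E1. c (f ` e)) \<psi>"
    show False
    proof (cases "k \<ge> 2")
      case True
      \<comment> \<open>\<open>f\<close> is injective only on endpoints of edges, so each vertex of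
        the copy has to be placed on an edge, which takes a second index.\<close>
      have "\<psi> i \<in> \<Union>E1" if "i < k" for i
      proof -
        have "\<exists>j<k. j \<noteq> i"
          using True by (intro exI[of _ "if i = 0 then 1 else 0"]) auto
        then obtain j where "j < k" "j \<noteq> i"
          by blast
        then show ?thesis
          using emb_edge[OF emb that, of j] by auto
      qed
      then have "\<psi> ` {..<k} \<subseteq> \<Union>E1"
        by auto
      then have "inj_on (f \<circ> \<psi>) {..<k}"
        using emb assms(1) comp_inj_on inj_on_subset unfolding emb_def by metis
      moreover have "{f (\<psi> i), f (\<psi> j)} \<in> E2" if "i < k" "j < k" "i \<noteq> j" for i j
      proof -
        have "f ` {\<psi> i, \<psi> j} \<in> E2"
          using emb_edge[OF emb that] assms(2) by blast
        then show ?thesis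
          by simp
      qed
      moreover have "(\<lambda>e\<in>E1. c (f ` e)) {\<psi> i, \<psi> j} = c {f (\<psi> i), f (\<psi> j)}"
        if "i < k" "j < k" "i \<noteq> j" for i j
        using emb_edge[OF emb that] by simp
      ultimately have "emb E2 c (f \<circ> \<psi>)"
        using emb by (simp add: emb_def)
      then show ?thesis
        using assms(3) by (auto simp: cols_def free_def)
    next
      case False
      \<comment> \<open>With \<open>k \<le> 1\<close> there are no two distinct indices, so every
        map satisfies \<open>emb\<close>.\<close>
      then have "i = j" if "i < k" "j < k" for i j
        using that by linarith
      then have "emb E2 c (f \<circ> \<psi>)"
        unfolding emb_def inj_on_def by blast
      then show ?thesis
        using assms(3) by (auto simp: cols_def free_def)
    qed
  qed
  then have "free E1 (\<lambda>e\<in>E1. c (f ` e))"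
    by (simp add: free_def)
  moreover have "(\<lambda>e\<in>E1. c (f ` e)) \<in> E1 \<rightarrow>\<^sub>E {1..r}"
    using assms(2,3) by (auto simp: cols_def)
  ultimately show ?thesis
    by (simp add: cols_def)
qed

lemma pullback_inj:
  assumes "E2 = (`) f ` E1"
  shows "inj_on (\<lambda>c. \<lambda>e\<in>E1. c (f ` e)) (cols E2)"
proof (rule inj_onI)
  fix c c' assume "c \<in> cols E2" "c' \<in> cols E2"
    and eq: "(\<lambda>e\<in>E1. c (f ` e)) = (\<lambda>e\<in>E1. c' (f ` e))"
  have "c (f ` e) = c' (f ` e)" if "e \<in> E1" for e
    using fun_cong[OF eq, of e] that by simp
  then show "c = c'"
    using \<open>c \<in> cols E2\<close> \<open>c' \<in> cols E2\<close> assms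
    by (intro PiE_ext[of c E2 "\<lambda>_. {1..r}" c']) (auto simp: cols_def)
qed

text \<open>Swapping the names \<open>u\<close> and \<open>v\<close> turns an extension to
  \<open>u\<close> into one to the twin and leaves the colours on edges missing both untouched. An
  injection is enough, as only this inequality is used later.\<close>

lemma card_exts_clone:
  assumes "simple E"
  shows "card (exts u (del v E) \<tau>) \<le> card (exts v (del u (clone u v E)) \<tau>)"
proof -
  let ?s = "transpose u v"
  let ?E1 = "del u (clone u v E)"
  let ?f = "\<lambda>c. \<lambda>e\<in>?E1. c (?s ` e)"
  have E1: "?E1 = (`) ?s ` del v E"
    by (rule del_clone_left)
  then have E2: "del v E = (`) ?s ` ?E1"
    by (simp add: image_image transpose_image_image)
  have E0: "del v ?E1 = del u (del v E)"
    by (metis del_clone_right del_commute)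
  have simple: "simple ?E1"
    unfolding E1 using simple_del[OF assms, of v] by (simp add: simple_def card_image)
  show ?thesis
  proof (rule card_inj_on_le)
    show "inj_on ?f (exts u (del v E) \<tau>)"
      using pullback_inj[OF E2] by (rule inj_on_subset) (auto simp: exts_def)
    show "?f ` exts u (del v E) \<tau> \<subseteq> exts v ?E1 \<tau>"
    proof safe
      fix c assume c: "c \<in> exts u (del v E) \<tau>"
      have "?f c \<in> cols ?E1"
        using c by (intro pullback_cols[OF _ E2]) (auto simp: exts_def)
      moreover have "restrict (?f c) (del v ?E1) = restrict c (del v ?E1)"
        by (intro restrict_ext) (auto simp: del_def transpose_image_id)
      ultimately show "?f c \<in> exts v ?E1 \<tau>"
        using c by (simp add: exts_def E0)
    qed
    show "finite (exts v ?E1 \<tau>)"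
      using simple by (rule finite_exts)
  qed
qed

section \<open>Maximal graphs: equal extension counts and cloning\<close>

text \<open>Extremality relative to graphs on \<open>V\<close> itself, so that clones, which keep
  the vertex set, compete directly.\<close>

definition maximal :: "'a set \<Rightarrow> 'a set set \<Rightarrow> bool" where
  "maximal V E \<longleftrightarrow> graph V E \<and> (\<forall>E'. graph V E' \<longrightarrow> card (cols E') \<le> card (cols E))"

text \<open>In the clone, \<open>u\<close> and its twin are nonadjacent and the twin has at least as
  many extensions, so each product in \<open>card_cols_split\<close> is at least a square.\<close>

lemma clone_card_cols:
  assumes "graph V E" "u \<noteq> v"
  shows "(\<Sum>\<tau>\<in>cols (del u (del v E)). (card (exts u (del v E) \<tau>))\<^sup>2) \<le> card (cols (clone u v E))"
proof -
  have "simple (clone u v E)"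
    using graph_simple[OF assms(1)]
    by (auto simp: simple_def clone_def del_def card_image)
  then have "card (cols (clone u v E)) = (\<Sum>\<tau>\<in>cols (del u (del v E)).
     card (exts u (del v E) \<tau>) * card (exts v (del u (clone u v E)) \<tau>))"
    using card_cols_split[OF _ assms(2) clone_nonadjacent[OF assms(2)], of E]
    unfolding del_clone_right by blast
  moreover have "(\<Sum>\<tau>\<in>cols (del u (del v E)). (card (exts u (del v E) \<tau>))\<^sup>2) \<le> \<dots>"
    unfolding power2_eq_square
    by (intro sum_mono mult_le_mono2 card_exts_clone graph_simple[OF assms(1)])
  ultimately show ?thesis
    by linarith
qed

text \<open>The equality case of Cauchy--Schwarz.\<close>
lemma sum_squares_eq:
  fixes f g :: "'b \<Rightarrow> nat"
  assumes "finite A" "(\<Sum>x\<in>A. (f x)\<^sup>2) \<le> (\<Sum>x\<in>A. f x * g x)" "(\<Sum>x\<in>A. (g x)\<^sup>2) \<le> (\<Sum>x\<in>A. f x * g x)"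
    "x \<in> A"
  shows "f x = g x"
proof -
  \<comment> \<open>Natural subtraction truncates, hence the integers; the two hypotheses push the
    sum of squared differences down to 0.\<close>
  have "(\<Sum>x\<in>A. (int (f x) - int (g x))\<^sup>2) =
      int (\<Sum>x\<in>A. (f x)\<^sup>2) + int (\<Sum>x\<in>A. (g x)\<^sup>2) - 2 * int (\<Sum>x\<in>A. f x * g x)"
    by (simp add: power2_diff sum.distrib sum_subtractf sum_distrib_left mult.assoc)
  also have "\<dots> \<le> 0"
    using assms(2,3) by linarith
  finally have "(\<Sum>x\<in>A. (int (f x) - int (g x))\<^sup>2) = 0"
    by (intro antisym sum_nonneg) auto
  then show ?thesis
    using assms(1,4) by (subst (asm) sum_nonneg_eq_0_iff) auto
qed

text \<open>Let A and B count the extensions to \<open>u\<close> and to \<open>v\<close>. The graph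
  has as many free colourings as the sum of A*B, while its two clones have at least the sum of A*A
  and of B*B; by maximality Cauchy-Schwarz is tight and A = B termwise. The clone then reaches the
  maximum too.\<close>

lemma maximal_nonadjacent:
  assumes "maximal V E" "u \<in> V" "v \<in> V" "u \<noteq> v" "{u, v} \<notin> E"
  shows "\<tau> \<in> cols (del u (del v E)) \<Longrightarrow> card (exts u (del v E) \<tau>) = card (exts v (del u E) \<tau>)"
    and "maximal V (clone u v E)"
proof -
  have graph: "graph V E"
    using assms(1) by (simp add: maximal_def)
  note simple = graph_simple[OF graph]
  let ?T = "cols (del u (del v E))"
  let ?A = "\<lambda>\<tau>. card (exts u (del v E) \<tau>)" and ?B = "\<lambda>\<tau>. card (exts v (del u E) \<tau>)"
  have AB: "card (cols E) = (\<Sum>\<tau>\<in>?T. ?A \<tau> * ?B \<tau>)"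
    by (rule card_cols_split[OF simple assms(4,5)])
  have AA: "(\<Sum>\<tau>\<in>?T. (?A \<tau>)\<^sup>2) \<le> (\<Sum>\<tau>\<in>?T. ?A \<tau> * ?B \<tau>)"
  proof -
    have "(\<Sum>\<tau>\<in>?T. (?A \<tau>)\<^sup>2) \<le> card (cols (clone u v E))"
      by (rule clone_card_cols[OF graph assms(4)])
    also have "\<dots> \<le> card (cols E)"
      using assms(1) graph_clone[OF graph assms(2,3)] by (simp add: maximal_def)
    finally show ?thesis
      by (simp only: AB)
  qed
  have BB: "(\<Sum>\<tau>\<in>?T. (?B \<tau>)\<^sup>2) \<le> (\<Sum>\<tau>\<in>?T. ?A \<tau> * ?B \<tau>)"
  proof -
    have "(\<Sum>\<tau>\<in>?T. (?B \<tau>)\<^sup>2) \<le> card (cols (clone v u E))"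
      using clone_card_cols[OF graph assms(4)[symmetric]] by (simp only: del_commute[of v u])
    also have "\<dots> \<le> card (cols E)"
      using assms(1) graph_clone[OF graph assms(3,2)] by (simp add: maximal_def)
    finally show ?thesis
      by (simp only: AB)
  qed
  have fin: "finite ?T"
    using simple by (simp add: finite_cols simple_def del_def)
  have eq: "?A \<tau> = ?B \<tau>" if "\<tau> \<in> ?T" for \<tau>
    using sum_squares_eq[OF fin AA BB that] .
  then show "\<tau> \<in> ?T \<Longrightarrow> ?A \<tau> = ?B \<tau>" .
  have "card (cols E) = (\<Sum>\<tau>\<in>?T. (?A \<tau>)\<^sup>2)"
    unfolding AB using eq by (intro sum.cong) (auto simp: power2_eq_square)
  then have "card (cols E) \<le> card (cols (clone u v E))"
    using clone_card_cols[OF graph assms(4)] by simp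
  then show "maximal V (clone u v E)"
    using assms(1) graph_clone[OF graph assms(2,3)] by (auto simp: maximal_def intro: order_trans)
qed

lemma maximal_exts:
  assumes "maximal V E" "u \<in> V" "v \<in> V" "w \<in> V" "u \<noteq> v" "v \<noteq> w" "u \<noteq> w"
    "{u, v} \<notin> E" "{v, w} \<notin> E"
    and \<tau>: "\<tau> \<in> cols (del u (del v E))"
    and \<tau>': "\<tau>' \<in> cols (del u (del v (clone v w E)))"
    and \<sigma>: "restrict \<tau> (del u (del v (del w E))) = \<sigma>" "restrict \<tau>' (del u (del v (del w E))) = \<sigma>"
  shows "card (exts u (del v E) \<tau>) = card (exts u (del v (del w E)) \<sigma>)"
proof -
  let ?G = "clone v w E"
  have simple: "simple E" and G: "maximal V ?G"
    using assms maximal_nonadjacent(2)[of V E v w] graph_simple by (auto simp: maximal_def)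
  then have simpleG: "simple ?G"
    using graph_simple by (auto simp: maximal_def)
  have "transpose v w ` {u, w} = {u, v}"
    using assms by (simp add: transpose_def)
  then have "transpose v w ` e = {u, w} \<Longrightarrow> e = {u, v}" for e
    by (metis transpose_image_image)
  then have uwG: "{u, w} \<notin> ?G"
    using assms by (auto simp: clone_def del_def)
  have "{u, v} \<noteq> transpose v w ` e" if "w \<notin> e" for e
    using that transpose_mem_left[of v w e] by blast
  then have uvG: "{u, v} \<notin> ?G"
    using assms by (auto simp: clone_def del_def)
  have vwG: "{v, w} \<notin> ?G"
    using clone_nonadjacent assms by metis
  have delG: "del w ?G = del w E"
    by (rule del_clone_right)
  have "card (exts u (del v E) \<tau>) = card (exts v (del u E) \<tau>)"
    using maximal_nonadjacent(1)[OF assms(1,2,3,5,8) \<tau>] .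
  also have "\<dots> = card (exts v (del w (del u E)) (restrict \<tau> (del v (del w (del u E)))))"
    using assms \<tau> by (intro card_exts_del simple_del simple) (simp_all add: not_in_del del_commute)
  also have "\<dots> = card (exts v (del u (del w E)) \<sigma>)"
    using \<sigma> by (simp add: del_commute)
  \<comment> \<open>\<open>E\<close> and the clone agree without \<open>w\<close>, so the count
    continues in the clone, where \<open>\<tau>'\<close> supplies colours at the new
    \<open>w\<close>.\<close>
  also have "\<dots> = card (exts v (del w (del u ?G)) (restrict \<tau>' (del v (del w (del u ?G)))))"
    using \<sigma> by (metis del_commute delG)
  also have "\<dots> = card (exts v (del u ?G) \<tau>')"
    using assms \<tau>' vwG
    by (intro card_exts_del[symmetric] simple_del simpleG) (simp_all add: not_in_del del_commute)
  also have "\<dots> = card (exts u (del v ?G) \<tau>')"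
    using maximal_nonadjacent(1)[OF G assms(2,3,5) uvG \<tau>'] by simp
  also have "\<dots> = card (exts u (del w (del v ?G)) (restrict \<tau>' (del u (del w (del v ?G)))))"
    using assms \<tau>' uwG
    by (intro card_exts_del simple_del simpleG) (simp_all add: not_in_del del_commute)
  also have "\<dots> = card (exts u (del v (del w E)) \<sigma>)"
    using \<sigma> by (metis del_commute delG)
  finally show ?thesis .
qed

section \<open>Patterns that become monochromatic after deleting a vertex\<close>

definition near_mono :: bool where
  "near_mono \<longleftrightarrow> (\<exists>x<k. \<exists>y<k. x \<noteq> y \<and>
     (\<forall>i<k. \<forall>j<k. i \<noteq> j \<longrightarrow> i \<noteq> x \<longrightarrow> j \<noteq> x \<longrightarrow> F {i, j} = F {x, y}))"

text \<open>Colour equalities within a copy match those of \<open>F\<close>, so the property can be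
  read off from any copy.\<close>

lemma near_monoI:
  assumes "emb E c \<psi>" "x < k" "y < k" "x \<noteq> y"
    "\<And>i j. i < k \<Longrightarrow> j < k \<Longrightarrow> i \<noteq> j \<Longrightarrow> i \<noteq> x \<Longrightarrow> j \<noteq> x \<Longrightarrow> c {\<psi> i, \<psi> j} = c {\<psi> x, \<psi> y}"
  shows near_mono
proof -
  have "F {i, j} = F {x, y}" if "i < k" "j < k" "i \<noteq> j" "i \<noteq> x" "j \<noteq> x" for i j
    using assms(5)[OF that] emb_color[OF assms(1) that(1,2) assms(2,3) that(3) assms(4)] by simp
  then show ?thesis
    unfolding near_mono_def using assms(2-4) by blast
qed

lemma near_monoE:
  assumes near_mono "emb E c \<psi>"
  obtains x y where "x < k" "y < k" "x \<noteq> y"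
    "\<And>i j. i < k \<Longrightarrow> j < k \<Longrightarrow> i \<noteq> j \<Longrightarrow> i \<noteq> x \<Longrightarrow> j \<noteq> x \<Longrightarrow> c {\<psi> i, \<psi> j} = c {\<psi> x, \<psi> y}"
proof -
  obtain x y where xy: "x < k" "y < k" "x \<noteq> y"
    and eq: "\<And>i j. i < k \<Longrightarrow> j < k \<Longrightarrow> i \<noteq> j \<Longrightarrow> i \<noteq> x \<Longrightarrow> j \<noteq> x \<Longrightarrow> F {i, j} = F {x, y}"
    using assms(1) unfolding near_mono_def by blast
  have "c {\<psi> i, \<psi> j} = c {\<psi> x, \<psi> y}" if "i < k" "j < k" "i \<noteq> j" "i \<noteq> x" "j \<noteq> x" for i j
    using eq[OF that] emb_color[OF assms(2) that(1,2) xy(1,2) that(3) xy(3)] by simp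
  then show ?thesis
    using that xy by blast
qed

lemma fresh:
  assumes "length xs < k"
  obtains l where "l < k" "l \<notin> set xs"
proof -
  have "card (set xs) < card {..<k}"
    using assms card_length[of xs] by simp
  then have "\<not> {..<k} \<subseteq> set xs"
    by (meson List.finite_set card_mono leD)
  then show ?thesis
    using that by auto
qed

lemma free_const:
  assumes "\<not> monochromatic k F" "k \<ge> 2"
  shows "free E (\<lambda>_. a)"
  unfolding free_def
proof
  assume "\<exists>\<psi>. emb E (\<lambda>_. a) \<psi>"
  then obtain \<psi> where \<psi>: "emb E (\<lambda>_. a) \<psi>" ..
  have "F e = F {0, 1}" if "e \<in> Kedges k" for e
  proof -
    obtain i j where "e = {i, j}" "i < k" "j < k" "i \<noteq> j"
      using \<open>e \<in> Kedges k\<close> by (auto simp: Kedges_def)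
    then show ?thesis
      using emb_color[OF \<psi>, of i j 0 1] assms(2) by simp
  qed
  then show False
    using assms(1) by (auto simp: monochromatic_def)
qed

text \<open>A copy must use \<open>w\<close>, since elsewhere the colouring is constant. If the
  exceptional vertex \<open>x\<close> of the pattern sits at \<open>w\<close>, the rest has colour 1
  but all edges at \<open>x\<close> have colour 2; otherwise \<open>w\<close> and two further
  vertices, available because \<open>k \<ge> 4\<close>, survive the deletion of \<open>x\<close> and
  span both colours.\<close>

lemma free_star:
  assumes "\<not> monochromatic k F" "k \<ge> 4" near_mono
  shows "free E (\<lambda>e. if w \<in> e then 2 else 1)"
  unfolding free_def
proof
  let ?c = "\<lambda>e. if w \<in> e then 2 else (1::nat)"
  assume "\<exists>\<psi>. emb E ?c \<psi>"
  then obtain \<psi> where \<psi>: "emb E ?c \<psi>" ..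
  have "free (del w E) ?c"
    by (rule free_subset[OF free_const[OF assms(1), of "del w E" 1]]) (use assms(2) in \<open>auto simp: del_def\<close>)
  then obtain b where b: "b < k" "\<psi> b = w"
    using emb_avoid[OF \<psi>] by blast
  have one: "?c {\<psi> i, \<psi> j} = 1" if "i < k" "j < k" "i \<noteq> b" "j \<noteq> b" for i j
    using emb_inj[OF \<psi> that(1) b(1)] emb_inj[OF \<psi> that(2) b(1)] b(2) that by auto
  have two: "?c {\<psi> b, \<psi> i} = 2" for i
    using b(2) by simp
  obtain x y where xy: "x < k" "y < k" "x \<noteq> y"
    and eq: "\<And>i j. i < k \<Longrightarrow> j < k \<Longrightarrow> i \<noteq> j \<Longrightarrow> i \<noteq> x \<Longrightarrow> j \<noteq> x \<Longrightarrow> ?c {\<psi> i, \<psi> j} = ?c {\<psi> x, \<psi> y}"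
    using near_monoE[OF assms(3) \<psi>] by blast
  obtain l where l: "l < k" "l \<noteq> b" "l \<noteq> x"
    using fresh[of "[b, x]"] assms(2) by auto
  obtain m where m: "m < k" "m \<noteq> b" "m \<noteq> x" "m \<noteq> l"
    using fresh[of "[b, x, l]"] assms(2) by auto
  show False
  proof (cases "x = b")
    case True
    then show ?thesis
      using eq[OF l(1) m(1)] one[OF l(1) m(1)] two[of y] l m by simp
  next
    case False
    then show ?thesis
      using eq[OF l(1) m(1)] eq[OF b(1) l(1)] one[OF l(1) m(1)] two[of l] l m by simp
  qed
qed

lemma same_patternI:
  assumes "emb E c \<psi>" "bij_betw \<phi> {0..<k} {0..<k'}"
    "\<And>i j. i < k \<Longrightarrow> j < k \<Longrightarrow> i \<noteq> j \<Longrightarrow> c {\<psi> i, \<psi> j} = G {\<phi> i, \<phi> j}"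
  shows "same_pattern k F k' G"
proof -
  have "F e = F e' \<longleftrightarrow> G (\<phi> ` e) = G (\<phi> ` e')" if "e \<in> Kedges k" "e' \<in> Kedges k" for e e'
  proof -
    obtain i j i' j' where "e = {i, j}" "i < k" "j < k" "i \<noteq> j" "e' = {i', j'}" "i' < k" "j' < k" "i' \<noteq> j'"
      using \<open>e \<in> Kedges k\<close> \<open>e' \<in> Kedges k\<close> by (auto simp: Kedges_def)
    then show ?thesis
      using emb_color[OF assms(1), of i j i' j'] assms(3)[of i j] assms(3)[of i' j'] by simp
  qed
  then show ?thesis
    unfolding same_pattern_def using assms(2) by blast
qed

text \<open>The edges \<open>xy\<close> and \<open>yz\<close> share a colour, so \<open>xz\<close>
  must differ from them. Excluding \<open>T0\<close> therefore forces \<open>k \<ge> 4\<close> in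
  the near-monochromatic case.\<close>

lemma near_mono_triangle:
  assumes "k = 3" near_mono "\<not> monochromatic k F"
  shows "same_pattern k F 3 T0"
proof -
  obtain x y where xy: "x < k" "y < k" "x \<noteq> y"
    and eq: "\<And>i j. i < k \<Longrightarrow> j < k \<Longrightarrow> i \<noteq> j \<Longrightarrow> i \<noteq> x \<Longrightarrow> j \<noteq> x \<Longrightarrow> F {i, j} = F {x, y}"
    using assms(2) unfolding near_mono_def by blast
  obtain z where z: "z < k" "z \<noteq> x" "z \<noteq> y"
    using fresh[of "[x, y]"] assms(1) by auto
  have ver: "i = x \<or> i = y \<or> i = z" if "i < k" for i
    using that xy z assms(1) by linarith
  have yz: "F {y, z} = F {x, y}"
    using eq[of y z] xy z by simp
  have edges: "e = {x, y} \<or> e = {y, z} \<or> e = {x, z}" if "e \<in> Kedges k" for e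
  proof -
    obtain i j where "e = {i, j}" "i < k" "j < k" "i \<noteq> j"
      using \<open>e \<in> Kedges k\<close> by (auto simp: Kedges_def)
    then show ?thesis
      using ver[of i] ver[of j] by (auto simp: insert_commute)
  qed
  have xz: "F {x, z} \<noteq> F {x, y}"
  proof
    assume "F {x, z} = F {x, y}"
    then have "\<forall>e\<in>Kedges k. F e = F {x, y}"
      using edges yz by fastforce
    then show False
      using assms(3) by (auto simp: monochromatic_def)
  qed
  \<comment> \<open>\<open>y\<close>, the common vertex of the two equally coloured edges, becomes
    the middle vertex 1 of \<open>T0\<close>.\<close>
  define \<phi> where "\<phi> i = (if i = x then 0 else if i = y then 1 else (2::nat))" for i
  have \<phi>: "\<phi> x = 0" "\<phi> y = 1" "\<phi> z = 2"
    using xy z by (auto simp: \<phi>_def)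
  then have T0: "T0 (\<phi> ` {x, y}) = 1" "T0 (\<phi> ` {y, z}) = 1" "T0 (\<phi> ` {x, z}) = 2"
    by (auto simp: T0_def doubleton_eq_iff)
  have "F e = (if T0 (\<phi> ` e) = 2 then F {x, z} else F {x, y})" if "e \<in> Kedges k" for e
    using edges[OF that] T0 yz by auto
  moreover have "T0 (\<phi> ` e) = 1 \<or> T0 (\<phi> ` e) = 2" for e
    by (simp add: T0_def)
  ultimately have "\<forall>e\<in>Kedges k. \<forall>e'\<in>Kedges k. F e = F e' \<longleftrightarrow> T0 (\<phi> ` e) = T0 (\<phi> ` e')"
    using xz by (metis one_eq_numeral_iff semiring_norm(85))
  moreover have "bij_betw \<phi> {0..<k} {0..<3}"
  proof (rule bij_betw_imageI)
    show inj: "inj_on \<phi> {0..<k}"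
    proof (rule inj_onI)
        fix i j assume "i \<in> {0..<k}" "j \<in> {0..<k}" "\<phi> i = \<phi> j"
        then show "i = j"
          using ver[of i] ver[of j] \<phi> by auto
      qed
    have "\<phi> ` {0..<k} \<subseteq> {0..<3}"
      by (auto simp: \<phi>_def)
    then show "\<phi> ` {0..<k} = {0..<3}"
      using card_image[OF inj] assms(1) by (intro card_subset_eq) auto
  qed
  ultimately show ?thesis
    unfolding same_pattern_def by blast
qed

section \<open>Completing an extension by a colour of the edge uw\<close>

text \<open>Merges \<open>\<alpha>\<close>, an extension to \<open>u\<close> of the colouring
  constant 1, with the colouring \<open>star_col w g\<close>; \<open>q\<close> is left for the one
  edge that neither of them sees.\<close>

definition edge_col :: "'a \<Rightarrow> 'a \<Rightarrow> nat \<Rightarrow> nat \<Rightarrow> ('a set \<Rightarrow> nat) \<Rightarrow> 'a set \<Rightarrow> nat" where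
  "edge_col u w g q \<alpha> e = (if e = {u, w} then q else if w \<in> e then g else if u \<in> e then \<alpha> e else 1)"

definition star_col :: "'a \<Rightarrow> nat \<Rightarrow> 'a set set \<Rightarrow> 'a set \<Rightarrow> nat" where
  "star_col w g E = (\<lambda>e\<in>E. if w \<in> e then g else 1)"

text \<open>Restriction to \<open>del w D\<close> sends each completion back to its
  \<open>\<alpha>\<close>. By \<open>ex\<close> every extension of \<open>\<sigma>\<close> is
  reached, and \<open>\<alpha>0\<close> is reached twice, by completions that differ on
  \<open>uw\<close>.\<close>

lemma exts_gap:
  assumes "simple D" "{u, w} \<in> D" "g \<in> {1..r}"
    and \<sigma>: "\<sigma> = (\<lambda>e\<in>del u (del w D). 1)"
    and ex: "\<And>\<alpha>. \<alpha> \<in> exts u (del w D) \<sigma> \<Longrightarrow> \<exists>q\<in>{1..r}. free D (edge_col u w g q \<alpha>)"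
    and \<alpha>0: "\<alpha>0 \<in> exts u (del w D) \<sigma>" "p \<in> {1..r}" "q \<in> {1..r}" "p \<noteq> q"
      "free D (edge_col u w g p \<alpha>0)" "free D (edge_col u w g q \<alpha>0)"
  shows "card (exts u (del w D) \<sigma>) < card (exts u D (star_col w g (del u D)))"
proof (rule ccontr)
  let ?A = "exts u (del w D) \<sigma>" and ?B = "exts u D (star_col w g (del u D))"
  let ?h = "\<lambda>q \<alpha>. restrict (edge_col u w g q \<alpha>) D"
  let ?f = "\<lambda>c. restrict c (del w D)"
  assume "\<not> ?thesis"
  then have le: "card ?B \<le> card ?A"
    by simp
  have h: "?h q \<alpha> \<in> ?B \<and> ?f (?h q \<alpha>) = \<alpha>"
    if \<alpha>: "\<alpha> \<in> ?A" and q: "q \<in> {1..r}" and free: "free D (edge_col u w g q \<alpha>)" for q \<alpha>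
  proof -
    have \<alpha>1: "\<alpha> e = 1" if "e \<in> del w D" "u \<notin> e" for e
    proof -
      have "restrict \<alpha> (del u (del w D)) e = \<sigma> e"
        using \<alpha> by (simp add: exts_def)
      then show ?thesis
        using that by (simp add: \<sigma> del_def)
    qed
    have \<alpha>r: "\<alpha> \<in> del w D \<rightarrow>\<^sub>E {1..r}"
      using \<alpha> by (simp add: exts_def cols_def)
    have "edge_col u w g q \<alpha> e \<in> {1..r}" if "e \<in> D" for e
    proof (cases "w \<in> e")
      case False
      then have "\<alpha> e \<in> {1..r}"
        using PiE_mem[OF \<alpha>r, of e] that by (simp add: del_def)
      then show ?thesis
        using assms(3) q by (auto simp: edge_col_def)
    qed (use assms(3) q in \<open>auto simp: edge_col_def\<close>)
    then have "?h q \<alpha> \<in> D \<rightarrow>\<^sub>E {1..r}"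
      by auto
    moreover have "free D (?h q \<alpha>)"
      using free by (rule free_subset) auto
    moreover have "restrict (?h q \<alpha>) (del u D) = star_col w g (del u D)"
      by (rule ext) (auto simp: star_col_def edge_col_def del_def)
    moreover have "?f (?h q \<alpha>) = \<alpha>"
    proof
      fix e
      show "?f (?h q \<alpha>) e = \<alpha> e"
      proof (cases "e \<in> del w D")
        case True
        then show ?thesis
          using \<alpha>1[OF True] by (auto simp: edge_col_def del_def)
      next
        case False
        then show ?thesis
          using PiE_arb[OF \<alpha>r] by simp
      qed
    qed
    ultimately show ?thesis
      by (simp add: exts_def cols_def)
  qed
  have "\<alpha> \<in> ?f ` ?B" if "\<alpha> \<in> ?A" for \<alpha>
    using ex[OF that] h[OF that] by (metis imageI)
  then have "?A \<subseteq> ?f ` ?B"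
    by blast
  moreover have fin: "finite ?B"
    by (rule finite_exts[OF assms(1)])
  ultimately have "card ?A \<le> card (?f ` ?B)"
    by (intro card_mono) auto
  \<comment> \<open>Under the contrary assumption the cardinalities squeeze, making the restriction
    injective on \<open>?B\<close>; the two completions of \<open>\<alpha>0\<close> refute
    this.\<close>
  then have "card (?f ` ?B) = card ?B"
    using le card_image_le[OF fin, of ?f] by linarith
  then have "inj_on ?f ?B"
    using fin by (simp add: eq_card_imp_inj_on)
  then have "?h p \<alpha>0 = ?h q \<alpha>0"
    using h[OF \<alpha>0(1,2,5)] h[OF \<alpha>0(1,3,6)] by (metis inj_onD)
  then have "?h p \<alpha>0 {u, w} = ?h q \<alpha>0 {u, w}"
    by simp
  then show False
    using assms(2) \<open>p \<noteq> q\<close> by (simp add: edge_col_def)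
qed

text \<open>A copy missing \<open>w\<close> would be a copy in \<open>\<alpha>\<close>, one missing
  \<open>u\<close> a copy in the star colouring, and both are free. So the copy contains
  \<open>u\<close> and \<open>w\<close>, and only its edges from \<open>u\<close> to vertices other
  than \<open>w\<close> have colours that depend on \<open>\<alpha>\<close>.\<close>

lemma edge_col_emb:
  assumes "u \<noteq> w" and \<alpha>: "\<alpha> \<in> exts u (del w D) (\<lambda>e\<in>del u (del w D). 1)"
    and "star_col w g (del u D) \<in> cols (del u D)"
    and \<psi>: "emb D (edge_col u w g q \<alpha>) \<psi>"
  obtains a b where "a < k" "b < k" "a \<noteq> b" "\<psi> a = u" "\<psi> b = w"
    "edge_col u w g q \<alpha> {\<psi> a, \<psi> b} = q"
    "\<forall>i<k. i \<noteq> a \<longrightarrow> i \<noteq> b \<longrightarrow> edge_col u w g q \<alpha> {\<psi> b, \<psi> i} = g"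
    "\<forall>i<k. i \<noteq> a \<longrightarrow> i \<noteq> b \<longrightarrow> edge_col u w g q \<alpha> {\<psi> a, \<psi> i} = \<alpha> {\<psi> a, \<psi> i} \<and>
       {\<psi> a, \<psi> i} \<in> del w D"
    "\<forall>i<k. \<forall>j<k. i \<noteq> a \<longrightarrow> i \<noteq> b \<longrightarrow> j \<noteq> a \<longrightarrow> j \<noteq> b \<longrightarrow>
       edge_col u w g q \<alpha> {\<psi> i, \<psi> j} = 1"
proof -
  have "\<alpha> e = 1" if "e \<in> del w D" "u \<notin> e" for e
  proof -
    have "restrict \<alpha> (del u (del w D)) e = (\<lambda>e\<in>del u (del w D). 1) e"
      using \<alpha> by (simp add: exts_def)
    then show ?thesis
      using that by (simp add: del_def)
  qed
  then have "edge_col u w g q \<alpha> e = \<alpha> e" if "e \<in> del w D" for e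
    using that by (auto simp: edge_col_def del_def)
  then have "free (del w D) (edge_col u w g q \<alpha>)"
    using \<alpha> free_subset[of "del w D" \<alpha> "del w D" "edge_col u w g q \<alpha>"]
    by (simp add: exts_def cols_def)
  then obtain b where b: "b < k" "\<psi> b = w"
    using emb_avoid[OF \<psi>] by blast
  have "free (del u D) (edge_col u w g q \<alpha>)"
  proof (rule free_subset)
    show "free (del u D) (star_col w g (del u D))"
      using assms(3) by (simp add: cols_def)
  qed (auto simp: star_col_def edge_col_def del_def)
  then obtain a where a: "a < k" "\<psi> a = u"
    using emb_avoid[OF \<psi>] by blast
  have ab: "a \<noteq> b"
    using a b assms(1) by auto
  have u: "u = \<psi> i \<longleftrightarrow> i = a" and w: "w = \<psi> i \<longleftrightarrow> i = b" if "i < k" for i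
    using emb_inj[OF \<psi> that a(1)] emb_inj[OF \<psi> that b(1)] a(2) b(2) by auto
  have "edge_col u w g q \<alpha> {\<psi> a, \<psi> b} = q"
    using a b by (simp add: edge_col_def)
  moreover have "edge_col u w g q \<alpha> {\<psi> b, \<psi> i} = g" if "i < k" "i \<noteq> a" "i \<noteq> b" for i
    using a b u[of i] w[of i] that assms(1) by (auto simp: edge_col_def doubleton_eq_iff)
  moreover have "edge_col u w g q \<alpha> {\<psi> a, \<psi> i} = \<alpha> {\<psi> a, \<psi> i} \<and> {\<psi> a, \<psi> i} \<in> del w D"
    if "i < k" "i \<noteq> a" "i \<noteq> b" for i
    using a b u[of i] w[of i] w[of a] that assms(1) emb_edge[OF \<psi> a(1) that(1)]
    by (auto simp: edge_col_def doubleton_eq_iff del_def)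
  moreover have "edge_col u w g q \<alpha> {\<psi> i, \<psi> j} = 1"
    if "i < k" "j < k" "i \<noteq> a" "i \<noteq> b" "j \<noteq> a" "j \<noteq> b" for i j
    using u[of i] w[of i] u[of j] w[of j] that by (auto simp: edge_col_def doubleton_eq_iff)
  ultimately show ?thesis
    using that[OF a(1) b(1) ab a(2) b(2)] by simp
qed

section \<open>The two choices of colours at w and their strict inequalities\<close>

lemma star_col_exts:
  assumes "t \<in> {1..r}" "free (del w D) (\<lambda>e. if u \<in> e then t else 1)"
  shows "star_col u t (del w D) \<in> exts u (del w D) (\<lambda>e\<in>del u (del w D). 1)"
proof -
  have "free (del w D) (star_col u t (del w D))"
    using assms(2) by (rule free_subset) (auto simp: star_col_def)
  moreover have "star_col u t (del w D) \<in> del w D \<rightarrow>\<^sub>E {1..r}"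
    using assms(1) by (auto simp: star_col_def)
  moreover have "restrict (star_col u t (del w D)) (del u (del w D)) = (\<lambda>e\<in>del u (del w D). 1)"
    by (rule ext) (auto simp: star_col_def del_def)
  ultimately show ?thesis
    by (simp add: exts_def cols_def)
qed

lemma star_col_cols:
  assumes "t \<in> {1..r}" "free E (\<lambda>e. if w \<in> e then t else 1)"
  shows "star_col w t E \<in> cols E"
proof -
  have "free E (star_col w t E)"
    using assms(2) by (rule free_subset) (auto simp: star_col_def)
  then show ?thesis
    using assms(1) by (auto simp: star_col_def cols_def)
qed

text \<open>With constant 1 off \<open>u\<close>, a copy through \<open>u\<close> makes
  \<open>F\<close> near-monochromatic as soon as one of its edges at \<open>u\<close> has colour 1.
  Giving \<open>uw\<close> colour 1 thus completes every \<open>\<alpha>\<close>; for the constant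
  \<open>\<alpha>\<close>, colour 2 on \<open>uw\<close> works as well.\<close>

lemma gap_not_near_mono:
  assumes "r \<ge> 2" "k \<ge> 3" "\<not> monochromatic k F" "\<not> near_mono"
    and D: "simple D" "u \<noteq> w" "{u, w} \<in> D"
  shows "card (exts u (del w D) (\<lambda>e\<in>del u (del w D). 1)) < card (exts u D (star_col w 1 (del u D)))"
proof -
  have free1: "free E (\<lambda>e. if x \<in> e then 1 else 1)" for E and x :: 'a
    using free_const[OF assms(3)] assms(2) by simp
  note cols = star_col_cols[OF _ free1]
  let ?\<alpha> = "star_col u 1 (del w D)"
  have \<alpha>: "?\<alpha> \<in> exts u (del w D) (\<lambda>e\<in>del u (del w D). 1)"
    using assms(1) by (intro star_col_exts free1) simp
  have good: "free D (edge_col u w 1 1 \<alpha>)" if \<alpha>': "\<alpha> \<in> exts u (del w D) (\<lambda>e\<in>del u (del w D). 1)" for \<alpha>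
    unfolding free_def
  proof
    assume "\<exists>\<psi>. emb D (edge_col u w 1 1 \<alpha>) \<psi>"
    then obtain \<psi> where \<psi>: "emb D (edge_col u w 1 1 \<alpha>) \<psi>" ..
    have star: "star_col w 1 (del u D) \<in> cols (del u D)"
      using cols assms(1) by simp
    obtain a b where ab: "a < k" "b < k" "a \<noteq> b" "\<psi> a = u" "\<psi> b = w"
      and uw: "edge_col u w 1 1 \<alpha> {\<psi> a, \<psi> b} = 1"
      and wi: "\<forall>i<k. i \<noteq> a \<longrightarrow> i \<noteq> b \<longrightarrow> edge_col u w 1 1 \<alpha> {\<psi> b, \<psi> i} = 1"
      and ui: "\<forall>i<k. i \<noteq> a \<longrightarrow> i \<noteq> b \<longrightarrow> edge_col u w 1 1 \<alpha> {\<psi> a, \<psi> i} = \<alpha> {\<psi> a, \<psi> i} \<and>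
        {\<psi> a, \<psi> i} \<in> del w D"
      and ij: "\<forall>i<k. \<forall>j<k. i \<noteq> a \<longrightarrow> i \<noteq> b \<longrightarrow> j \<noteq> a \<longrightarrow> j \<noteq> b \<longrightarrow>
        edge_col u w 1 1 \<alpha> {\<psi> i, \<psi> j} = 1"
      by (rule edge_col_emb[OF D(2) \<alpha>' star \<psi>])
      note wi = wi[rule_format] and ui = ui[rule_format] and ij = ij[rule_format]
    have "edge_col u w 1 1 \<alpha> {\<psi> i, \<psi> j} = 1"
      if "i < k" "j < k" "i \<noteq> j" "i \<noteq> a" "j \<noteq> a" for i j
      using that wi[of i] wi[of j] ij[of i j] by (cases "i = b"; cases "j = b") (auto simp: insert_commute)
    then have near_mono
      using ab uw by (intro near_monoI[OF \<psi>, of a b]) auto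
    then show False
      using assms(4) by simp
  qed
  have "free D (edge_col u w 1 2 ?\<alpha>)"
    unfolding free_def
  proof
    assume "\<exists>\<psi>. emb D (edge_col u w 1 2 ?\<alpha>) \<psi>"
    then obtain \<psi> where \<psi>: "emb D (edge_col u w 1 2 ?\<alpha>) \<psi>" ..
    have star: "star_col w 1 (del u D) \<in> cols (del u D)"
      using cols assms(1) by simp
    obtain a b where ab: "a < k" "b < k" "a \<noteq> b" "\<psi> a = u" "\<psi> b = w"
      and uw: "edge_col u w 1 2 ?\<alpha> {\<psi> a, \<psi> b} = 2"
      and wi: "\<forall>i<k. i \<noteq> a \<longrightarrow> i \<noteq> b \<longrightarrow> edge_col u w 1 2 ?\<alpha> {\<psi> b, \<psi> i} = 1"
      and ui: "\<forall>i<k. i \<noteq> a \<longrightarrow> i \<noteq> b \<longrightarrow> edge_col u w 1 2 ?\<alpha> {\<psi> a, \<psi> i} = ?\<alpha> {\<psi> a, \<psi> i} \<and>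
        {\<psi> a, \<psi> i} \<in> del w D"
      and ij: "\<forall>i<k. \<forall>j<k. i \<noteq> a \<longrightarrow> i \<noteq> b \<longrightarrow> j \<noteq> a \<longrightarrow> j \<noteq> b \<longrightarrow>
        edge_col u w 1 2 ?\<alpha> {\<psi> i, \<psi> j} = 1"
      by (rule edge_col_emb[OF D(2) \<alpha> star \<psi>])
      note wi = wi[rule_format] and ui = ui[rule_format] and ij = ij[rule_format]
    \<comment> \<open>As \<open>k \<ge> 3\<close>, the copy has a vertex besides \<open>u\<close>
      and \<open>w\<close>; its edge to \<open>u\<close> has colour 1 because
      \<open>?\<alpha>\<close> is constant.\<close>
    obtain l where l: "l < k" "l \<noteq> a" "l \<noteq> b"
      using fresh[of "[a, b]"] assms(2) by auto
    have "edge_col u w 1 2 ?\<alpha> {\<psi> a, \<psi> l} = 1"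
      using ui[OF l] by (simp add: star_col_def)
    moreover have "edge_col u w 1 2 ?\<alpha> {\<psi> i, \<psi> j} = 1"
      if "i < k" "j < k" "i \<noteq> j" "i \<noteq> a" "j \<noteq> a" for i j
      using that wi[of i] wi[of j] ij[of i j] by (cases "i = b"; cases "j = b") (auto simp: insert_commute)
    ultimately have near_mono
      using l ab by (intro near_monoI[OF \<psi>, of a l]) auto
    then show False
      using assms(4) by simp
  qed
  moreover have r: "1 \<in> {1..r}" "2 \<in> {1..r}" "(1::nat) \<noteq> 2"
    using assms(1) by auto
  ultimately show ?thesis
    using exts_gap[OF D(1,3) r(1) refl _ \<alpha> r good[OF \<alpha>]] good by blast
qed

text \<open>The alternatives locate the exceptional vertex \<open>x\<close> of the pattern. If it
  sits at \<open>w\<close>, the rest has colour 1, which at \<open>w\<close> can occur only on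
  \<open>uw\<close>. Otherwise some \<open>l\<close> outside \<open>u\<close>, \<open>w\<close>,
  \<open>x\<close> has \<open>wl\<close> of colour 2, so the pattern off \<open>x\<close> has colour
  2; as edges avoiding \<open>u\<close> and \<open>w\<close> have colour 1, \<open>l\<close> and
  \<open>x\<close> are the only further vertices and \<open>k = 4\<close>.\<close>

lemma near_mono_edge_col_emb:
  assumes "\<not> monochromatic k F" "k \<ge> 4" near_mono "r \<ge> 2" "u \<noteq> w"
    and \<alpha>: "\<alpha> \<in> exts u (del w D) (\<lambda>e\<in>del u (del w D). 1)"
    and \<psi>: "emb D (edge_col u w 2 q \<alpha>) \<psi>"
  shows "q = 1 \<and> (\<forall>i<k. \<psi> i \<noteq> u \<longrightarrow> \<psi> i \<noteq> w \<longrightarrow> \<alpha> {u, \<psi> i} = 1) \<and>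
      (\<exists>i<k. \<alpha> {u, \<psi> i} = 1 \<and> {u, \<psi> i} \<in> del w D) \<or>
    k = 4 \<and> q = 2 \<and> (\<exists>i<k. \<alpha> {u, \<psi> i} = 2 \<and> {u, \<psi> i} \<in> del w D)"
proof -
  let ?c = "edge_col u w 2 q \<alpha>"
  have star: "star_col w 2 (del u D) \<in> cols (del u D)"
    using star_col_cols[OF _ free_star[OF assms(1-3)]] assms(4) by simp
  obtain a b where ab: "a < k" "b < k" "a \<noteq> b" "\<psi> a = u" "\<psi> b = w"
    and uw: "?c {\<psi> a, \<psi> b} = q"
    and wi: "\<forall>i<k. i \<noteq> a \<longrightarrow> i \<noteq> b \<longrightarrow> ?c {\<psi> b, \<psi> i} = 2"
    and ui: "\<forall>i<k. i \<noteq> a \<longrightarrow> i \<noteq> b \<longrightarrow> ?c {\<psi> a, \<psi> i} = \<alpha> {\<psi> a, \<psi> i} \<and> {\<psi> a, \<psi> i} \<in> del w D"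
    and ij: "\<forall>i<k. \<forall>j<k. i \<noteq> a \<longrightarrow> i \<noteq> b \<longrightarrow> j \<noteq> a \<longrightarrow> j \<noteq> b \<longrightarrow> ?c {\<psi> i, \<psi> j} = 1"
    by (rule edge_col_emb[OF \<open>u \<noteq> w\<close> \<alpha> star \<psi>])
    note wi = wi[rule_format] and ui = ui[rule_format] and ij = ij[rule_format]
  obtain x y where xy: "x < k" "y < k" "x \<noteq> y"
    and eq: "\<And>i j. i < k \<Longrightarrow> j < k \<Longrightarrow> i \<noteq> j \<Longrightarrow> i \<noteq> x \<Longrightarrow> j \<noteq> x \<Longrightarrow> ?c {\<psi> i, \<psi> j} = ?c {\<psi> x, \<psi> y}"
    using near_monoE[OF assms(3) \<psi>] by blast
  obtain l where l: "l < k" "l \<noteq> a" "l \<noteq> b" "l \<noteq> x"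
    using fresh[of "[a, b, x]"] assms(2) by auto
  show ?thesis
  proof (cases "x = b")
    case True
    obtain m where m: "m < k" "m \<noteq> a" "m \<noteq> b" "m \<noteq> l"
      using fresh[of "[a, b, l]"] assms(2) by auto
    have 1: "?c {\<psi> x, \<psi> y} = 1"
      using eq[of l m] ij[of l m] l m True by simp
    then have "y = a"
      using wi[of y] xy True by fastforce
    then have "q = 1"
      using 1 uw True by (simp add: insert_commute)
    moreover have "\<alpha> {u, \<psi> i} = 1" if "i < k" "i \<noteq> a" "i \<noteq> b" for i
      using eq[of a i] ui[OF that] that ab 1 True by auto
    \<comment> \<open>An actual edge of colour 1 at \<open>u\<close> is recorded, so that this
      alternative can be refuted for an \<open>\<alpha>\<close> without such edges.\<close>
    moreover have "{u, \<psi> l} \<in> del w D"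
      using ui[of l] l ab by simp
    ultimately show ?thesis
      using l ab by metis
  next
    case False
    then have 2: "?c {\<psi> x, \<psi> y} = 2"
      using eq[of b l] wi[of l] l ab by simp
    \<comment> \<open>An edge \<open>lm\<close> surviving the deletion of \<open>x\<close> would
      have colour 1 instead of 2.\<close>
    have no: "m = x" if "m < k" "m \<noteq> a" "m \<noteq> b" "m \<noteq> l" for m
      using eq[of l m] ij[of l m] l that 2 by fastforce
    have "x \<noteq> a"
    proof
      assume "x = a"
      obtain m where "m < k" "m \<noteq> a" "m \<noteq> b" "m \<noteq> l"
        using fresh[of "[a, b, l]"] assms(2) by auto
      then show False
        using no \<open>x = a\<close> by blast
    qed
    have "k = 4"
    proof (rule ccontr)
      assume "k \<noteq> 4"
      then obtain m where "m < k" "m \<noteq> a" "m \<noteq> b" "m \<noteq> l" "m \<noteq> x"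
        using fresh[of "[a, b, l, x]"] assms(2) by auto
      then show False
        using no by blast
    qed
    moreover have "q = 2"
      using eq[of a b] uw ab 2 False \<open>x \<noteq> a\<close> by simp
    moreover have "\<alpha> {u, \<psi> l} = 2" "{u, \<psi> l} \<in> del w D"
      using eq[of a l] ui[of l] l ab 2 \<open>x \<noteq> a\<close> by auto
    ultimately show ?thesis
      using l by blast
  qed
qed

text \<open>For \<open>q = 1\<close> only the first alternative of
  \<open>near_mono_edge_col_emb\<close> remains, so colour 2 occurs exactly on the two edges from
  \<open>w\<close> to the vertices other than \<open>u\<close>.\<close>

lemma same_pattern_P2:
  assumes "\<not> monochromatic k F" "k = 4" near_mono "r \<ge> 2" "u \<noteq> w"
    and \<alpha>: "\<alpha> \<in> exts u (del w D) (\<lambda>e\<in>del u (del w D). 1)"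
    and \<psi>: "emb D (edge_col u w 2 1 \<alpha>) \<psi>"
  shows "same_pattern k F 4 P2"
proof -
  let ?c = "edge_col u w 2 1 \<alpha>"
  have star: "star_col w 2 (del u D) \<in> cols (del u D)"
    using star_col_cols[OF _ free_star[OF assms(1) _ assms(3)]] assms(2,4) by simp
  obtain a b where ab: "a < k" "b < k" "a \<noteq> b" "\<psi> a = u" "\<psi> b = w"
    and uw: "?c {\<psi> a, \<psi> b} = 1"
    and wi: "\<forall>i<k. i \<noteq> a \<longrightarrow> i \<noteq> b \<longrightarrow> ?c {\<psi> b, \<psi> i} = 2"
    and ui: "\<forall>i<k. i \<noteq> a \<longrightarrow> i \<noteq> b \<longrightarrow> ?c {\<psi> a, \<psi> i} = \<alpha> {\<psi> a, \<psi> i} \<and> {\<psi> a, \<psi> i} \<in> del w D"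
    and ij: "\<forall>i<k. \<forall>j<k. i \<noteq> a \<longrightarrow> i \<noteq> b \<longrightarrow> j \<noteq> a \<longrightarrow> j \<noteq> b \<longrightarrow> ?c {\<psi> i, \<psi> j} = 1"
    by (rule edge_col_emb[OF \<open>u \<noteq> w\<close> \<alpha> star \<psi>])
    note wi = wi[rule_format] and ui = ui[rule_format] and ij = ij[rule_format]
  have \<alpha>1: "\<forall>i<k. \<psi> i \<noteq> u \<longrightarrow> \<psi> i \<noteq> w \<longrightarrow> \<alpha> {u, \<psi> i} = 1"
    using near_mono_edge_col_emb[OF assms(1) _ assms(3-5) \<alpha> \<psi>] assms(2) by simp
  have ui1: "?c {\<psi> a, \<psi> i} = 1" if "i < k" "i \<noteq> a" "i \<noteq> b" for i
    using ui[OF that] \<alpha>1 that ab emb_inj[OF \<psi>] by metis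
  obtain l where l: "l < k" "l \<noteq> a" "l \<noteq> b"
    using fresh[of "[a, b]"] assms(2) by auto
  obtain m where m: "m < k" "m \<noteq> a" "m \<noteq> b" "m \<noteq> l"
    using fresh[of "[a, b, l]"] assms(2) by auto
  have ver: "i = a \<or> i = b \<or> i = l \<or> i = m" if "i < k" for i
  proof -
    have "{a, b, l, m} = {..<k}"
      using ab l m assms(2) by (intro card_subset_eq) auto
    then show ?thesis
      using that by blast
  qed
  \<comment> \<open>\<open>w\<close>, the common end of the two edges of colour 2, becomes vertex 0
    of \<open>P2\<close>, and \<open>u\<close>, joined to it in colour 1, becomes vertex 2.\<close>
  define \<phi> where "\<phi> i = (if i = b then 0 else if i = l then 1 else if i = a then 2 else (3::nat))" for i
  have \<phi>: "\<phi> b = 0" "\<phi> l = 1" "\<phi> a = 2" "\<phi> m = 3"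
    using ab l m by (auto simp: \<phi>_def)
  show ?thesis
  proof (rule same_patternI[OF \<psi>])
    show "bij_betw \<phi> {0..<k} {0..<4}"
    proof (rule bij_betw_imageI)
      show inj: "inj_on \<phi> {0..<k}"
      proof (rule inj_onI)
        fix i j assume "i \<in> {0..<k}" "j \<in> {0..<k}" "\<phi> i = \<phi> j"
        then show "i = j"
          using ver[of i] ver[of j] \<phi> by auto
      qed
      have "\<phi> ` {0..<k} \<subseteq> {0..<4}"
        by (auto simp: \<phi>_def)
      then show "\<phi> ` {0..<k} = {0..<4}"
        using card_image[OF inj] assms(2) by (intro card_subset_eq) auto
    qed
    have P2: "P2 {2, 0} = 1" "P2 {0, 1} = 2" "P2 {0, 3} = 2" "P2 {2, 1} = 1" "P2 {2, 3} = 1" "P2 {1, 3} = 1"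
      by (simp_all add: P2_def doubleton_eq_iff)
    define Q where "Q i j \<longleftrightarrow> ?c {\<psi> i, \<psi> j} = P2 {\<phi> i, \<phi> j}" for i j
    have "Q a b" "Q b l" "Q b m" "Q a l" "Q a m" "Q l m"
      unfolding Q_def \<phi> P2 using uw wi[of l] wi[of m] ui1[of l] ui1[of m] ij[of l m] l m by simp_all
    moreover have "Q j i" if "Q i j" for i j
      using that unfolding Q_def insert_commute[of "\<psi> j"] insert_commute[of "\<phi> j"] .
    ultimately have "Q i j" if "i < k" "j < k" "i \<noteq> j" for i j
      using ver[OF that(1)] ver[OF that(2)] that(3) by (elim disjE) simp_all
    then show "?c {\<psi> i, \<psi> j} = P2 {\<phi> i, \<phi> j}" if "i < k" "j < k" "i \<noteq> j" for i j
      using that unfolding Q_def by blast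
  qed
qed

text \<open>The colour of \<open>uw\<close> that completes every extension is 2 if
  \<open>k \<noteq> 4\<close>, 3 if \<open>r \<ge> 3\<close>, and 1 if \<open>k = 4\<close> and
  \<open>r = 2\<close>, where a failure would give the pattern \<open>P2\<close>. One extension
  admits a second colour: all edges at \<open>u\<close> coloured 2 in the first two cases, all
  coloured 1 in the last.\<close>

lemma gap_near_mono:
  assumes "r \<ge> 2" "k \<ge> 4" "\<not> monochromatic k F" near_mono "r = 2 \<longrightarrow> \<not> same_pattern k F 4 P2"
    and D: "simple D" "u \<noteq> w" "{u, w} \<in> D"
  shows "card (exts u (del w D) (\<lambda>e\<in>del u (del w D). 1)) < card (exts u D (star_col w 2 (del u D)))"
proof -
  let ?A = "exts u (del w D) (\<lambda>e\<in>del u (del w D). 1)"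
  let ?free = "\<lambda>q \<alpha>. free D (edge_col u w 2 q \<alpha>)"
  note emb = near_mono_edge_col_emb[OF assms(3,2,4,1) D(2)]
  let ?one = "star_col u 1 (del w D)" and ?two = "star_col u 2 (del w D)"
  have one: "?one \<in> ?A"
    using free_const[OF assms(3), of "del w D" 1] assms(1,2) by (intro star_col_exts) simp_all
  have two: "?two \<in> ?A"
    using star_col_exts[OF _ free_star[OF assms(3,2,4)]] assms(1) by simp
  \<comment> \<open>With \<open>q = 2\<close> a copy needs an edge at \<open>u\<close> to which
    \<open>\<alpha>\<close> gives colour 2, with \<open>q = 1\<close> one of colour 1;
    \<open>?one\<close> and \<open>?two\<close> respectively have none.\<close>
  have one2: "?free 2 ?one"
    unfolding free_def using emb[OF one] by (fastforce simp: star_col_def)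
  have two1: "?free 1 ?two"
    unfolding free_def using emb[OF two] by (fastforce simp: star_col_def)
  have many: "?free 2 \<alpha>" if "\<alpha> \<in> ?A" "k \<noteq> 4" for \<alpha>
    unfolding free_def using emb[OF that(1)] that(2) by fastforce
  have three: "?free 3 \<alpha>" if "\<alpha> \<in> ?A" for \<alpha>
    unfolding free_def using emb[OF that(1)] by fastforce
  have "\<exists>\<alpha>0\<in>?A. \<exists>p\<in>{1..r}. \<exists>q\<in>{1..r}. p \<noteq> q \<and> ?free p \<alpha>0 \<and> ?free q \<alpha>0"
    and "\<forall>\<alpha>\<in>?A. \<exists>q\<in>{1..r}. ?free q \<alpha>"
  proof -
    consider "k \<noteq> 4" | "r \<ge> 3" | "k = 4" "r = 2"
      using assms(1) by linarith
    then have "(\<exists>\<alpha>0\<in>?A. \<exists>p\<in>{1..r}. \<exists>q\<in>{1..r}. p \<noteq> q \<and> ?free p \<alpha>0 \<and> ?free q \<alpha>0) \<and>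
        (\<forall>\<alpha>\<in>?A. \<exists>q\<in>{1..r}. ?free q \<alpha>)"
    proof cases
      case 1
      have "1 \<in> {1..r}" "2 \<in> {1..r}" "(1::nat) \<noteq> 2"
        using assms(1) by auto
      then show ?thesis
        using two two1 many 1 by blast
    next
      case 2
      then have "1 \<in> {1..r}" "3 \<in> {1..r}" "(1::nat) \<noteq> 3"
        by auto
      then show ?thesis
        using two two1 three by blast
    next
      case 3
      have "1 \<in> {1..r}" "2 \<in> {1..r}" "(1::nat) \<noteq> 2"
        using assms(1) by auto
      moreover have "?free 1 \<alpha>" if "\<alpha> \<in> ?A" for \<alpha>
        unfolding free_def using same_pattern_P2[OF assms(3) 3(1) assms(4,1) D(2) that] assms(5) 3(2) by blast
      ultimately show ?thesis
        using one one2 by blast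
    qed
    then show "\<exists>\<alpha>0\<in>?A. \<exists>p\<in>{1..r}. \<exists>q\<in>{1..r}. p \<noteq> q \<and> ?free p \<alpha>0 \<and> ?free q \<alpha>0"
      and "\<forall>\<alpha>\<in>?A. \<exists>q\<in>{1..r}. ?free q \<alpha>"
      by blast+
  qed
  then obtain \<alpha>0 p q where "\<alpha>0 \<in> ?A" "p \<in> {1..r}" "q \<in> {1..r}" "p \<noteq> q" "?free p \<alpha>0" "?free q \<alpha>0"
    and ex: "\<And>\<alpha>. \<alpha> \<in> ?A \<Longrightarrow> \<exists>q\<in>{1..r}. ?free q \<alpha>"
    by blast
  moreover have "2 \<in> {1..r}"
    using assms(1) by simp
  ultimately show ?thesis
    using exts_gap[OF D(1,3), of 2, OF _ refl ex] by blast
qed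

section \<open>The strict inequality in general and transitivity of nonadjacency\<close>

lemma gap:
  assumes "r \<ge> 2" "k \<ge> 3" "\<not> monochromatic k F" "\<not> same_pattern k F 3 T0"
    "r = 2 \<longrightarrow> \<not> same_pattern k F 4 P2"
    and D: "simple D" "u \<noteq> w" "{u, w} \<in> D"
  obtains g where "star_col w g (del u D) \<in> cols (del u D)"
    "card (exts u (del w D) (\<lambda>e\<in>del u (del w D). 1)) < card (exts u D (star_col w g (del u D)))"
proof (cases near_mono)
  case True
  then have "k \<ge> 4"
    \<comment> \<open>A near-monochromatic pattern on three vertices would be
      \<open>T0\<close>.\<close>
    using near_mono_triangle assms(2-4) by fastforce
  moreover from this have "star_col w 2 (del u D) \<in> cols (del u D)"
    using star_col_cols[OF _ free_star[OF assms(3) _ True]] assms(1) by simp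
  ultimately show ?thesis
    using gap_near_mono[OF assms(1) _ assms(3) True assms(5) D] that by blast
next
  case False
  have "star_col w 1 (del u D) \<in> cols (del u D)"
    using free_const[OF assms(3), of "del u D" 1] assms(1,2) by (intro star_col_cols) simp_all
  then show ?thesis
    using gap_not_near_mono[OF assms(1-3) False D] that by blast
qed

text \<open>If \<open>uw\<close> were an edge, \<open>gap\<close> for the graph without
  \<open>v\<close> would give a star colouring with more extensions to \<open>u\<close> than its
  restriction has, whereas \<open>maximal_exts\<close> makes the two numbers equal.\<close>

lemma maximal_trans:
  assumes "r \<ge> 2" "k \<ge> 3" "\<not> monochromatic k F" "\<not> same_pattern k F 3 T0"
    "r = 2 \<longrightarrow> \<not> same_pattern k F 4 P2"
    and "maximal V E" "u \<in> V" "v \<in> V" "w \<in> V" "u \<noteq> v" "v \<noteq> w" "u \<noteq> w"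
    "{u, v} \<notin> E" "{v, w} \<notin> E"
  shows "{u, w} \<notin> E"
proof
  assume "{u, w} \<in> E"
  then have uw: "{u, w} \<in> del v E"
    using assms by (simp add: del_def)
  have "simple (del v E)"
    using assms(6) graph_simple[of V E] by (simp add: maximal_def simple_del)
  then obtain g where g: "star_col w g (del u (del v E)) \<in> cols (del u (del v E))"
    and gap: "card (exts u (del w (del v E)) (\<lambda>e\<in>del u (del w (del v E)). 1)) <
      card (exts u (del v E) (star_col w g (del u (del v E))))"
    using gap[OF assms(1-5) _ assms(12) uw] by blast
  let ?\<tau> = "star_col w g (del u (del v E))"
  \<comment> \<open>The constant colouring is free because \<open>F\<close> is not monochromatic,
    and it has the same restriction as \<open>?\<tau>\<close>.\<close>
  let ?\<tau>' = "\<lambda>e\<in>del u (del v (clone v w E)). 1"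
  have \<tau>': "?\<tau>' \<in> cols (del u (del v (clone v w E)))"
  proof -
    have "?\<tau>' = star_col w 1 (del u (del v (clone v w E)))"
      by (rule ext) (simp add: star_col_def)
    then show ?thesis
      using free_const[OF assms(3), of "del u (del v (clone v w E))" 1] assms(1,2)
        star_col_cols[of 1 "del u (del v (clone v w E))" w] by simp
  qed
  have "del w (clone v w E) = del w E"
    by (rule del_clone_right)
  then have sub: "e \<in> del u (del v (clone v w E))" if "e \<in> del u (del v (del w E))" for e
    using that by (auto simp: del_def)
  have "card (exts u (del v E) ?\<tau>) = card (exts u (del v (del w E)) (\<lambda>e\<in>del u (del v (del w E)). 1))"
  proof (rule maximal_exts[OF assms(6-14) g \<tau>'])
    show "restrict ?\<tau> (del u (del v (del w E))) = (\<lambda>e\<in>del u (del v (del w E)). 1)"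
      by (rule ext) (auto simp: star_col_def del_def)
    show "restrict ?\<tau>' (del u (del v (del w E))) = (\<lambda>e\<in>del u (del v (del w E)). 1)"
      by (rule ext) (use sub in auto)
  qed
  then show False
    using gap by (simp add: del_commute)
qed

section \<open>From copies and counts to maximal graphs\<close>

text \<open>The labelling of a copy and the embedding are inverse maps; \<open>k \<ge> 2\<close>
  puts each vertex of an embedding on an edge, hence in \<open>V\<close>.\<close>

lemma F_free_iff:
  assumes "graph V E" "k \<ge> 2"
  shows "F_free V E c k F \<longleftrightarrow> free E c"
proof -
  have "is_copy V E c k F (\<psi> ` {..<k})" if \<psi>: "emb E c \<psi>" for \<psi>
  proof -
    let ?S = "\<psi> ` {..<k}" and ?\<phi> = "inv_into {..<k} \<psi>"
    have inj: "inj_on \<psi> {..<k}"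
      using \<psi> by (simp add: emb_def)
    have "\<psi> i \<in> V" if "i < k" for i
    proof -
      obtain j where "j < k" "j \<noteq> i"
        using fresh[of "[i]"] assms(2) by auto
      then have "{\<psi> i, \<psi> j} \<in> E"
        using emb_edge[OF \<psi> that] by blast
      then show ?thesis
        using assms(1) by (auto simp: graph_def doubleton_eq_iff)
    qed
    then have "?S \<subseteq> V"
      by auto
    moreover have "card ?S = k"
      using card_image[OF inj] by simp
    moreover have "\<forall>x\<in>?S. \<forall>y\<in>?S. x \<noteq> y \<longrightarrow> {x, y} \<in> E"
      using emb_edge[OF \<psi>] by force
    moreover have "bij_betw ?\<phi> ?S {0..<k}"
      using bij_betw_inv_into[OF inj_on_imp_bij_betw[OF inj]] by (simp add: lessThan_atLeast0)
    moreover have "\<forall>x\<in>?S. \<forall>y\<in>?S. \<forall>x'\<in>?S. \<forall>y'\<in>?S. x \<noteq> y \<longrightarrow> x' \<noteq> y' \<longrightarrow>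
        (c {x, y} = c {x', y'} \<longleftrightarrow> F {?\<phi> x, ?\<phi> y} = F {?\<phi> x', ?\<phi> y'})"
    proof (intro ballI impI)
      fix x y x' y' assume "x \<in> ?S" "y \<in> ?S" "x' \<in> ?S" "y' \<in> ?S" and ne: "x \<noteq> y" "x' \<noteq> y'"
      then obtain i j i' j' where "x = \<psi> i" "y = \<psi> j" "x' = \<psi> i'" "y' = \<psi> j'"
        and lt: "i < k" "j < k" "i' < k" "j' < k"
        by auto
      moreover have "?\<phi> (\<psi> i) = i" if "i < k" for i
        using that inj by simp
      ultimately show "c {x, y} = c {x', y'} \<longleftrightarrow> F {?\<phi> x, ?\<phi> y} = F {?\<phi> x', ?\<phi> y'}"
        using emb_color[OF \<psi> lt] ne by metis
    qed
    ultimately show ?thesis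
      unfolding is_copy_def by blast
  qed
  moreover have "\<exists>\<psi>. emb E c \<psi>" if copy: "is_copy V E c k F S" for S
  proof -
    obtain \<phi> where \<phi>: "bij_betw \<phi> S {0..<k}"
      and edge: "\<And>x y. x \<in> S \<Longrightarrow> y \<in> S \<Longrightarrow> x \<noteq> y \<Longrightarrow> {x, y} \<in> E"
      and col: "\<And>x y x' y'. x \<in> S \<Longrightarrow> y \<in> S \<Longrightarrow> x' \<in> S \<Longrightarrow> y' \<in> S \<Longrightarrow> x \<noteq> y \<Longrightarrow> x' \<noteq> y' \<Longrightarrow>
        c {x, y} = c {x', y'} \<longleftrightarrow> F {\<phi> x, \<phi> y} = F {\<phi> x', \<phi> y'}"
      using copy unfolding is_copy_def by blast
    let ?\<psi> = "inv_into S \<phi>"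
    have bij: "bij_betw ?\<psi> {0..<k} S"
      by (rule bij_betw_inv_into[OF \<phi>])
    then have inj: "inj_on ?\<psi> {..<k}" and mem: "\<And>i. i < k \<Longrightarrow> ?\<psi> i \<in> S"
      by (auto simp: bij_betw_def lessThan_atLeast0)
    have \<phi>\<psi>: "\<phi> (?\<psi> i) = i" if "i < k" for i
      using bij_betw_inv_into_right[OF \<phi>] that by simp
    have ne: "?\<psi> i \<noteq> ?\<psi> j" if "i < k" "j < k" "i \<noteq> j" for i j
      using \<phi>\<psi> that by metis
    have "emb E c ?\<psi>"
      unfolding emb_def
    proof (intro conjI allI impI)
      show "inj_on ?\<psi> {..<k}"
        by (rule inj)
      show "{?\<psi> i, ?\<psi> j} \<in> E" if "i < k" "j < k" "i \<noteq> j" for i j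
        using edge[OF mem mem ne] that by blast
      show "c {?\<psi> i, ?\<psi> j} = c {?\<psi> i', ?\<psi> j'} \<longleftrightarrow> F {i, j} = F {i', j'}"
        if "i < k" "j < k" "i' < k" "j' < k" "i \<noteq> j" "i' \<noteq> j'" for i j i' j'
        using col[OF mem[OF that(1)] mem[OF that(2)] mem[OF that(3)] mem[OF that(4)]
            ne[OF that(1,2,5)] ne[OF that(3,4,6)]] \<phi>\<psi> that by simp
    qed
    then show ?thesis
      by (rule exI[of _ ?\<psi>])
  qed
  ultimately show ?thesis
    unfolding F_free_def free_def by blast
qed

lemma count_free_eq: "graph V E \<Longrightarrow> k \<ge> 2 \<Longrightarrow> count_free r k F V E = card (cols E)"
  by (simp add: count_free_def cols_def F_free_iff)

text \<open>\<open>count_free_n\<close> ranges over graphs on \<open>{0..<n}\<close>, so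
  \<open>V\<close> is numbered and colourings are pulled back along the numbering; distinct ones
  stay distinct because each edge of \<open>E\<close> is an image.\<close>

lemma card_cols_le_count_free_n:
  assumes "graph V E" "k \<ge> 2"
  shows "card (cols E) \<le> count_free_n r k F (card V)"
proof -
  let ?n = "card V"
  have "finite V"
    using assms(1) by (simp add: graph_def)
  then obtain f where f: "bij_betw f {0..<?n} V"
    using ex_bij_betw_nat_finite by blast
  define g where "g = inv_into {0..<?n} f"
  have g: "bij_betw g V {0..<?n}"
    unfolding g_def by (rule bij_betw_inv_into[OF f])
  have fg: "f (g x) = x" if "x \<in> V" for x
    unfolding g_def using bij_betw_inv_into_right[OF f that] .
  define E' where "E' = (`) g ` E"
  have sub: "e \<subseteq> V" if "e \<in> E" for e
    using assms(1) that by (auto simp: graph_def)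
  have "f ` g ` e = e" if "e \<in> E" for e
    using fg sub[OF that] by (force simp: image_iff)
  then have E: "E = (`) f ` E'"
    by (auto simp: E'_def image_image)
  have "E' \<subseteq> {{x, y} | x y. x \<in> {0..<?n} \<and> y \<in> {0..<?n} \<and> x \<noteq> y}"
  proof
    fix e assume "e \<in> E'"
    then obtain x y where xy: "e = {g x, g y}" "x \<in> V" "y \<in> V" "x \<noteq> y"
      using assms(1) by (auto simp: E'_def graph_def)
    moreover have "g x \<in> {0..<?n}" "g y \<in> {0..<?n}" "g x \<noteq> g y"
      using xy g fg by (auto simp: bij_betw_def inj_on_def)
    ultimately show "e \<in> {{x, y} | x y. x \<in> {0..<?n} \<and> y \<in> {0..<?n} \<and> x \<noteq> y}"
      by blast
  qed
  then have graph': "graph {0..<?n} E'"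
    by (simp add: graph_def)
  have "\<Union>E' \<subseteq> {0..<?n}"
    using graph' by (auto simp: graph_def)
  then have inj: "inj_on f (\<Union>E')"
    using f inj_on_subset by (auto simp: bij_betw_def)
  have "card (cols E) \<le> card (cols E')"
  proof (rule card_inj_on_le[OF pullback_inj[OF E]])
    show "(\<lambda>c. \<lambda>e\<in>E'. c (f ` e)) ` cols E \<subseteq> cols E'"
      using pullback_cols[OF inj E] by blast
    show "finite (cols E')"
      using graph_simple[OF graph'] by (simp add: simple_def finite_cols)
  qed
  also have "\<dots> = count_free r k F {0..<?n} E'"
    using count_free_eq[OF graph' assms(2)] by simp
  also have "\<dots> \<le> count_free_n r k F ?n"
    unfolding count_free_n_def
  proof (rule Max_ge)
    have "{E. graph {0..<?n} E} \<subseteq> Pow (Pow {0..<?n})"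
      by (auto simp: graph_def)
    then have "finite {E. graph {0..<?n} E}"
      by (rule finite_subset) simp
    then show "finite {count_free r k F {0..<?n} E | E. graph {0..<?n} E}"
      by simp
  qed (use graph' in blast)
  finally show ?thesis .
qed

lemma extremal_maximal:
  assumes "extremal r k F V E" "k \<ge> 2"
  shows "maximal V E"
proof -
  have "graph V E" "card (cols E) = count_free_n r k F (card V)"
    using assms count_free_eq[of V E] by (simp_all add: extremal_def)
  then show ?thesis
    using card_cols_le_count_free_n[OF _ assms(2), of V] by (simp add: maximal_def)
qed

end

section \<open>The classes of nonadjacency as parts\<close>

lemma complete_multipartiteI:
  assumes "graph V E"
    and "\<And>u v w. u \<in> V \<Longrightarrow> v \<in> V \<Longrightarrow> w \<in> V \<Longrightarrow> u \<noteq> v \<Longrightarrow> v \<noteq> w \<Longrightarrow> u \<noteq> w \<Longrightarrow>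
      {u, v} \<notin> E \<Longrightarrow> {v, w} \<notin> E \<Longrightarrow> {u, w} \<notin> E"
  shows "complete_multipartite V E"
proof -
  \<comment> \<open>The diagonal belongs to \<open>R\<close>, since for \<open>u = v\<close> the set
    is a singleton and no edge.\<close>
  define R where "R = {(u, v). u \<in> V \<and> v \<in> V \<and> {u, v} \<notin> E}"
  have loop: "{u} \<notin> E" for u
    using graph_simple[OF assms(1)] by (auto simp: simple_def)
  have "trans R"
  proof (rule transI)
    fix x y z assume "(x, y) \<in> R" "(y, z) \<in> R"
    then show "(x, z) \<in> R"
      using assms(2)[of x y z] loop by (cases "x = y"; cases "y = z"; cases "x = z") (auto simp: R_def)
  qed
  then have R: "equiv V R"
    using loop by (auto simp: equiv_def refl_on_def sym_def R_def insert_commute)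
  have "{u, v} \<in> E \<longleftrightarrow> \<not> (\<exists>A\<in>V // R. u \<in> A \<and> v \<in> A)" if "u \<in> V" "v \<in> V" for u v
  proof -
    have "(\<exists>A\<in>V // R. u \<in> A \<and> v \<in> A) \<longleftrightarrow> (u, v) \<in> R"
      using R that by (metis equiv_class_self in_quotient_imp_in_rel Image_singleton_iff
          empty_subsetI insert_subset quotientI)
    then show ?thesis
      using that by (auto simp: R_def)
  qed
  then show ?thesis
    unfolding complete_multipartite_def using partition_on_quotient[OF R] by blast
qed

theorem theorem1p2:
  fixes r k :: nat and F :: "nat set \<Rightarrow> nat" and V :: "'a set" and E :: "'a set set"
  assumes "r \<ge> 2" and "k \<ge> 3"
    and "coloring_K r k F"
    and "\<not> monochromatic k F"
    and "\<not> same_pattern k F 3 T0"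
    and "r = 2 \<longrightarrow> \<not> same_pattern k F 4 P2"
    and "extremal r k F V E"
  shows "complete_multipartite V E"
proof (rule complete_multipartiteI)
  show "graph V E"
    using assms(7) by (simp add: extremal_def)
  have "maximal r k F V E"
    using extremal_maximal[OF assms(7)] assms(2) by simp
  then show "{u, w} \<notin> E"
    if "u \<in> V" "v \<in> V" "w \<in> V" "u \<noteq> v" "v \<noteq> w" "u \<noteq> w" "{u, v} \<notin> E" "{v, w} \<notin> E" for u v w
    using maximal_trans[OF assms(1,2,4,5,6) _ that] by blast
qed

end
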